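(* Let $\delta>0$, $\eta>0$, $\lambda>0$, $\nu>0$ with $\nu\lceil\delta\rceil\in(0,1)$, and let $\omega>0$, $\gamma\ge0$, $0<\alpha\le1$, $0<\beta\le1$, with $0<\beta\lceil\gamma\rceil/\gamma-r\alpha<1$ for all $r=0,\dots,\lceil\gamma\rceil$ if $\gamma\ne0$. Let $p_k(t)$, $k\ge0$, $t\ge0$, be the solution of the Cauchy problem $$\begin{cases}{}^C\mathbf{D}^{\gamma}_{\alpha,\beta,-\omega,0^+}\,p_k(t)=-\left\{\left[\eta+\lambda^\nu(1-B)^\nu\right]^\delta-\eta^\delta\right\}p_k(t),\\[4pt] p_k(0)=\delta_{k,0},\end{cases}$$ where ${}^C\mathbf{D}^{\gamma}_{\alpha,\beta,-\omega,0^+}$ is the regularized Prabhakar derivative in $t$ and $B$ is the backward-shift operator in $k$. Then the probability generating function $G(u,t)=\sum_{k=0}^\infty u^kp_k(t)$, $|u|\le1$, is $$G(u,t)=\sum_{j=0}^\infty\left\{-\left[(\eta+\lambda^\nu(1-u)^\nu)^\delta-\eta^\delta\right]t^\beta\right\}^jE_{\alpha,\beta j+1}^{\gamma j}(-\omega t^\alpha).$$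
   Context: The generalized Mittag-Leffler function is $E_{\kappa,\varpi}^{c}(x)=\sum_{r=0}^\infty\frac{x^r(c)_r}{r!\,\Gamma(\kappa r+\varpi)}$, with $(c)_r$ the Pochhammer symbol. The Riemann–Liouville derivative of order $a>0$ is $(D_{0+}^a f)(t)=\frac{1}{\Gamma(m-a)}\frac{\mathrm d^m}{\mathrm dt^m}\int_0^t\frac{f(y)}{(t-y)^{a-m+1}}\,\mathrm dy$, $m=[a]+1$. The Prabhakar derivative is, with auxiliary parameter $\theta$, $\Re(\theta)>0$, $$\mathbf{D}^{\gamma}_{\alpha,\beta,-\omega,0^+}f(t)=D_{0+}^{\beta+\theta}\int_0^t(t-y)^{\theta-1}E_{\alpha,\theta}^{-\gamma}\left[-\omega(t-y)^\alpha\right]f(y)\,\mathrm dy .$$ For $0<\beta\le1$ and $f$ absolutely continuous, the regularized Prabhakar derivative is ${}^C\mathbf{D}^{\gamma}_{\alpha,\beta,-\omega,0^+}f(t)=\mathbf{D}^{\gamma}_{\alpha,\beta,-\omega,0^+}\left[f(t)-f(0^+)\right]$. $B$ acts by $B(f_k)=f_{k-1}$, $B^r(f_k)=B(B^{r-1}(f_k))$, and $p_k\equiv0$ for $k<0$; $\delta_{k,0}$ is the Kronecker delta. The operator $[\eta+\lambda^\nu(1-B)^\nu]^\delta-\eta^\delta$ is the power series in $B$ obtained from the expansion at $z=0$ of $[\eta+\lambda^\nu(1-z)^\nu]^\delta-\eta^\delta=\sum_{i\ge0}c_iz^i$, i.e. it maps $p_k$ to $\sum_{i=0}^k c_i\,p_{k-i}$;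 formally it equals $\sum_{r=1}^\infty\binom{\delta}{r}\eta^{\delta-r}\lambda^{\nu r}\sum_{m=0}^\infty\binom{\nu r}{m}(-1)^mB^m$. *)

theory Defs
  imports "HOL-Complex_Analysis.Complex_Analysis"
begin

text \<open>Where \<open>\<kappa> r + \<mu>\<close> is a pole of \<open>Gamma\<close>, the library has \<open>Gamma = 0\<close> and division by zero gives \<open>0\<close>,
  which agrees with the usual convention \<open>1 / \<Gamma> = 0\<close>.\<close>

definition mittag_leffler3 :: "complex \<Rightarrow> complex \<Rightarrow> complex \<Rightarrow> complex \<Rightarrow> complex" where
  "mittag_leffler3 \<kappa> \<mu> c x =
     (\<Sum>r. x ^ r * pochhammer c r / (fact r * Gamma (\<kappa> * of_nat r + \<mu>)))"

text \<open>Absolute continuity on a compact interval (the library's \<open>absolutely_continuous\<close> is about measures).\<close>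

definition absolutely_continuous_fun :: "real \<Rightarrow> real \<Rightarrow> (real \<Rightarrow> 'a::metric_space) \<Rightarrow> bool" where
  "absolutely_continuous_fun c d f \<longleftrightarrow>
     (\<forall>\<epsilon>>0. \<exists>\<rho>>0. \<forall>(n::nat) (a::nat \<Rightarrow> real) (b::nat \<Rightarrow> real).
        (\<forall>i<n. c \<le> a i \<and> a i \<le> b i \<and> b i \<le> d) \<and>
        disjoint_family_on (\<lambda>i. {a i<..<b i}) {..<n} \<and>
        (\<Sum>i<n. b i - a i) < \<rho> \<longrightarrow>
        (\<Sum>i<n. dist (f (a i)) (f (b i))) < \<epsilon>)"

text \<open>Riemann--Liouville derivative. The order is complex, because the auxiliary parameter \<open>\<theta>\<close> of the
  Prabhakar derivative is only required to satisfy \<open>Re \<theta> > 0\<close>; then \<open>m = [Re a] + 1\<close>, which is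
  \<open>[a] + 1\<close> for real \<open>a\<close>. Since \<open>vector_derivative\<close> is total, existence of the \<open>m\<close>-fold
  derivative is expressed separately, by \<open>RL_differentiable\<close>.\<close>

definition RL_index :: "complex \<Rightarrow> nat" where
  "RL_index a = nat (\<lfloor>Re a\<rfloor> + 1)"

definition RL_integral :: "complex \<Rightarrow> (real \<Rightarrow> complex) \<Rightarrow> real \<Rightarrow> complex" where
  "RL_integral a f t =
     (LBINT y:{0..t}. f y / complex_of_real (t - y) powr (a - of_nat (RL_index a) + 1))"

definition iter_deriv :: "nat \<Rightarrow> (real \<Rightarrow> complex) \<Rightarrow> real \<Rightarrow> complex" where
  "iter_deriv n f = ((\<lambda>g s. vector_derivative g (at s)) ^^ n) f"

definition RL_differentiable :: "complex \<Rightarrow> (real \<Rightarrow> complex) \<Rightarrow> bool" where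
  "RL_differentiable a f \<longleftrightarrow>
     (\<forall>i<RL_index a. \<forall>t>0. iter_deriv i (RL_integral a f) differentiable (at t))"

definition RL_derivative :: "complex \<Rightarrow> (real \<Rightarrow> complex) \<Rightarrow> real \<Rightarrow> complex" where
  "RL_derivative a f t =
     1 / Gamma (of_nat (RL_index a) - a) * iter_deriv (RL_index a) (RL_integral a f) t"

text \<open>The argument \<open>w\<close> below is the third lower index of the Prabhakar derivative, i.e. \<open>w = - \<omega>\<close>.\<close>

definition prabhakar_kernel_integral ::
    "complex \<Rightarrow> real \<Rightarrow> real \<Rightarrow> real \<Rightarrow> (real \<Rightarrow> complex) \<Rightarrow> real \<Rightarrow> complex" where
  "prabhakar_kernel_integral \<theta> \<gamma> \<alpha> w f t =
     (LBINT y:{0..t}. complex_of_real (t - y) powr (\<theta> - 1) *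
        mittag_leffler3 (of_real \<alpha>) \<theta> (- of_real \<gamma>) (of_real (w * (t - y) powr \<alpha>)) * f y)"

definition prabhakar_differentiable ::
    "complex \<Rightarrow> real \<Rightarrow> real \<Rightarrow> real \<Rightarrow> real \<Rightarrow> (real \<Rightarrow> complex) \<Rightarrow> bool" where
  "prabhakar_differentiable \<theta> \<gamma> \<alpha> \<beta> w f \<longleftrightarrow>
     RL_differentiable (of_real \<beta> + \<theta>) (prabhakar_kernel_integral \<theta> \<gamma> \<alpha> w f)"

definition prabhakar_derivative ::
    "complex \<Rightarrow> real \<Rightarrow> real \<Rightarrow> real \<Rightarrow> real \<Rightarrow> (real \<Rightarrow> complex) \<Rightarrow> real \<Rightarrow> complex" where
  "prabhakar_derivative \<theta> \<gamma> \<alpha> \<beta> w f =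
     RL_derivative (of_real \<beta> + \<theta>) (prabhakar_kernel_integral \<theta> \<gamma> \<alpha> w f)"

definition reg_prabhakar_differentiable ::
    "complex \<Rightarrow> real \<Rightarrow> real \<Rightarrow> real \<Rightarrow> real \<Rightarrow> (real \<Rightarrow> complex) \<Rightarrow> bool" where
  "reg_prabhakar_differentiable \<theta> \<gamma> \<alpha> \<beta> w f \<longleftrightarrow>
     prabhakar_differentiable \<theta> \<gamma> \<alpha> \<beta> w (\<lambda>t. f t - Lim (at_right 0) f)"

definition reg_prabhakar_derivative ::
    "complex \<Rightarrow> real \<Rightarrow> real \<Rightarrow> real \<Rightarrow> real \<Rightarrow> (real \<Rightarrow> complex) \<Rightarrow> real \<Rightarrow> complex" where
  "reg_prabhakar_derivative \<theta> \<gamma> \<alpha> \<beta> w f =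
     prabhakar_derivative \<theta> \<gamma> \<alpha> \<beta> w (\<lambda>t. f t - Lim (at_right 0) f)"

text \<open>Families \<open>q\<^sub>k\<close> vanish for \<open>k < 0\<close>, so the index type is \<open>nat\<close>, with \<open>B q 0 = 0\<close>. A power series
  \<open>F\<close> in \<open>B\<close> can be cut off at \<open>i = k\<close>, because \<open>(B ^^ i) q k = 0\<close> for \<open>i > k\<close>.\<close>

definition back_shift :: "(nat \<Rightarrow> complex) \<Rightarrow> nat \<Rightarrow> complex" where
  "back_shift q k = (if k = 0 then 0 else q (k - 1))"

definition fps_of_shift :: "complex fps \<Rightarrow> (nat \<Rightarrow> complex) \<Rightarrow> nat \<Rightarrow> complex" where
  "fps_of_shift F q k = (\<Sum>i\<le>k. fps_nth F i * (back_shift ^^ i) q k)"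

text \<open>The function \<open>(\<eta> + l\<^sup>\<nu> (1 - z)\<^sup>\<nu>)\<^sup>\<delta> - \<eta>\<^sup>\<delta>\<close>, with principal powers.\<close>

definition shift_symbol :: "real \<Rightarrow> real \<Rightarrow> real \<Rightarrow> real \<Rightarrow> complex \<Rightarrow> complex" where
  "shift_symbol \<eta> l \<nu> \<delta> z =
     (of_real \<eta> + of_real (l powr \<nu>) * (1 - z) powr of_real \<nu>) powr of_real \<delta>
       - of_real (\<eta> powr \<delta>)"

end

theory Submission
  imports Defs
begin

text \<open>Let \<open>k\<^sub>c\<^sub>,\<^sub>\<mu>(t) = t\<^bsup>\<mu>-1\<^esup> E\<^sup>c\<^sub>\<alpha>\<^sub>,\<^sub>\<mu>(w t\<^sup>\<alpha>)\<close>. Under the convolution \<open>(a * b)(t) = \<integral>\<^sub>0\<^sup>t a(t - y) b(y) dy\<close>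
  these kernels satisfy \<open>k\<^sub>c\<^sub>,\<^sub>\<mu> * k\<^sub>d\<^sub>,\<^sub>\<nu> = k\<^sub>c\<^sub>+\<^sub>d\<^sub>,\<^sub>\<mu>\<^sub>+\<^sub>\<nu>\<close>, by the Beta integral and Vandermonde's identity.
  The Prabhakar derivative of \<open>f\<close> is the \<open>m\<close>-th derivative of the convolution of \<open>f\<close> with \<open>k\<close> at parameters
  \<open>- \<gamma>\<close> and \<open>m - \<beta>\<close>. If \<open>f\<close> is continuous with \<open>f(0) = 0\<close> then that convolution is \<open>o(t\<^bsup>m-1\<^esup>)\<close>, so no
  Taylor polynomial appears when the \<open>m\<close> derivatives are integrated back, and convolving with \<open>k\<^sub>\<gamma>\<^sub>,\<^sub>\<beta>\<close> turns
  the Cauchy problem into \<open>p = \<delta> - k\<^sub>\<gamma>\<^sub>,\<^sub>\<beta> * F p\<close>, where \<open>F\<close> is the Taylor series of the symbol acting by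
  multiplication of power series in the index. Iterating gives \<open>p = \<Sum>\<^sub>n (- F)\<^sup>n h\<^sub>n\<close> with \<open>h\<^sub>n = k\<^sub>\<gamma>\<^sub>n\<^sub>,\<^sub>\<beta>\<^sub>n\<^sub>+\<^sub>1\<close>.
  The generating function may be taken termwise on the closed disc because \<open>F\<close> converges absolutely there:
  \<open>(1 - z)\<^sup>\<nu> = 1 - A(z)\<close> where \<open>A\<close> has nonnegative coefficients of sum at most \<open>1\<close>.\<close>

subsection \<open>Convolution on the half-line\<close>

text \<open>Write L = l^\<nu>. The formal expansion of the operator in powers of L (1 - B)^\<nu> /
  \<eta> need not converge when L is large compared with \<eta>. The symbol is therefore regrouped
  around \<eta> + L, as (\<eta> + L)^\<delta> (1 - q A)^\<delta> minus a constant, with q = L /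
  (\<eta> + L) < 1; this binomial series converges in coefficient norm for all positive L and
  \<eta>. The auxiliary \<theta> may be complex, but it cancels once the inner convolution is merged
  with the Riemann-Liouville kernel: the second parameters add up to the real number m - \<beta>.
  Differentiability is given only for t > 0, so integrating back leaves unknown constants at 0. For
  \<beta> = 1 the size of the kernel alone gives only O(t^(m-1)); there the condition f(0) = 0
  supplies the missing smallness. Nothing is assumed about the growth of p_k in k. For fixed k only
  p_0, ..., p_k enter the equation, so the iteration is run for each coefficient separately, with
  bounds that may depend on k. Summability over k comes out afterwards, from the explicit series and
  the submultiplicative norm given by the sum of the moduli of the coefficients.\<close>

definition lconv :: "(real \<Rightarrow> complex) \<Rightarrow> (real \<Rightarrow> complex) \<Rightarrow> real \<Rightarrow> complex" where
  "lconv a b t = (LBINT y:{0..t}. a (t - y) * b y)"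

definition loc_integrable :: "(real \<Rightarrow> complex) \<Rightarrow> bool" where
  "loc_integrable a \<longleftrightarrow> (\<forall>T. set_integrable lborel {0..T} a)"

text \<open>Cutting both factors off outside [0, t] turns \<open>lconv\<close> into a convolution
  over the whole line (\<open>lconv_eq_trunc\<close>), so that reflection, translation and Fubini
  for \<open>lborel\<close> apply without moving limits.\<close>

definition trunc :: "real \<Rightarrow> (real \<Rightarrow> complex) \<Rightarrow> real \<Rightarrow> complex" where
  "trunc T a x = indicator {0..T} x *\<^sub>R a x"

lemma integrable_trunc: "loc_integrable a \<Longrightarrow> integrable lborel (trunc T a)"
  unfolding loc_integrable_def set_integrable_def trunc_def[abs_def] by simp

lemma lconv_eq_trunc:
  assumes "s \<le> t"
  shows "lconv a b s = (\<integral>y. trunc t a (s - y) * trunc t b y \<partial>lborel)"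
  unfolding lconv_def set_lebesgue_integral_def trunc_def using assms
  by (intro Bochner_Integration.integral_cong refl) (auto simp: indicator_def)

text \<open>The endpoints y = 0 and y = t form a null set. This matters because the kernels below
  are 0 at 0, while functions they are exchanged for, such as the constant 1, are not.\<close>

lemma lconv_cong:
  assumes "\<And>x. 0 < x \<Longrightarrow> x \<le> t \<Longrightarrow> a x = a' x" "\<And>x. 0 < x \<Longrightarrow> x \<le> t \<Longrightarrow> b x = b' x"
  shows "lconv a b t = lconv a' b' t"
  unfolding lconv_def set_lebesgue_integral_def
  by (rule integral_discrete_difference[where X = "{0, t}"]) (auto simp: indicator_def assms)

lemma lconv_nonpos: "t \<le> 0 \<Longrightarrow> lconv a b t = 0"
proof -
  assume "t \<le> 0"
  then have "lconv a b t = (\<integral>y. 0 \<partial>(lborel :: real measure))"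
    unfolding lconv_def set_lebesgue_integral_def
    by (intro integral_discrete_difference[where X = "{0}"]) (auto simp: indicator_def)
  then show ?thesis by simp
qed

lemma lconv_commute: "lconv a b t = lconv b a t"
proof -
  have "lconv a b t = (\<integral>y. trunc t a (t - y) * trunc t b y \<partial>lborel)"
    by (rule lconv_eq_trunc) simp
  also have "\<dots> = (\<integral>y. trunc t b (t - y) * trunc t a y \<partial>lborel)"
    by (subst lborel_integral_real_affine[where c = "-1" and t = t]) (auto simp: mult.commute)
  also have "\<dots> = lconv b a t"
    by (rule lconv_eq_trunc[symmetric]) simp
  finally show ?thesis .
qed

lemma lconv_scale_left: "lconv (\<lambda>x. k * a x) b t = k * lconv a b t"
proof -
  have "lconv (\<lambda>x. k * a x) b t = (\<integral>y. k * (indicator {0..t} y *\<^sub>R (a (t - y) * b y)) \<partial>lborel)"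
    unfolding lconv_def set_lebesgue_integral_def
    by (intro Bochner_Integration.integral_cong refl) (auto simp: mult_ac)
  also have "\<dots> = k * lconv a b t"
    unfolding lconv_def set_lebesgue_integral_def by (rule integral_mult_right_zero)
  finally show ?thesis .
qed

lemma lconv_scale_right: "lconv a (\<lambda>x. k * b x) t = k * lconv a b t"
  using lconv_scale_left[of k b a t] by (simp add: lconv_commute)

text \<open>Composing with \<open>max 0\<close> extends a function continuous on the half-line to
  one continuous on the line. Measurability of \<open>trunc\<close> follows although nothing is
  known at negative arguments.\<close>

lemma trunc_continuous_eq: "trunc t c x = indicator {0..t} x *\<^sub>R c (max 0 x)"
  by (auto simp: trunc_def indicator_def)

lemma continuous_on_max0:
  fixes c :: "real \<Rightarrow> complex"
  assumes "continuous_on {0..} c" shows "continuous_on UNIV (\<lambda>x. c (max 0 x))"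
  by (rule continuous_on_compose2[OF assms]) (auto intro!: continuous_intros)

lemma trunc_bounded:
  assumes "continuous_on {0..} c"
  obtains C where "C > 0" "\<And>x. norm (trunc t c x) \<le> C"
proof -
  have "compact (c ` {0..t})"
    by (intro compact_continuous_image continuous_on_subset[OF assms]) auto
  then have "bounded (c ` {0..t})" by (rule compact_imp_bounded)
  then obtain C where C: "C > 0" "\<forall>z\<in>c ` {0..t}. norm z \<le> C" using bounded_pos by blast
  have "norm (trunc t c x) \<le> C" for x
    using C by (auto simp: trunc_def indicator_def)
  with C(1) that show ?thesis by blast
qed

lemma measurable_trunc:
  assumes "continuous_on {0..} c" shows "trunc t c \<in> borel_measurable borel"
proof -
  have [measurable]: "(\<lambda>x. c (max 0 x)) \<in> borel_measurable borel"
    by (intro borel_measurable_continuous_onI continuous_on_max0 assms)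
  show ?thesis unfolding trunc_continuous_eq[abs_def] by measurable
qed

lemma loc_integrable_continuous:
  assumes "continuous_on {0..} c" shows "loc_integrable c"
  unfolding loc_integrable_def
  by (intro allI borel_integrable_atLeastAtMost' continuous_on_subset[OF assms]) auto

lemma integrable_conv:
  assumes "loc_integrable a" "continuous_on {0..} c"
  shows "integrable lborel (\<lambda>y. trunc t a (s - y) * trunc t c y)"
proof -
  obtain C where C: "C > 0" "\<And>x. norm (trunc t c x) \<le> C" using trunc_bounded[OF assms(2)] by blast
  have i: "integrable lborel (\<lambda>y. trunc t a (s - y))"
    using lborel_integrable_real_affine[OF integrable_trunc[OF assms(1)], of "-1" t s] by simp
  note [measurable] = measurable_trunc[OF assms(2)] borel_measurable_integrable[OF i]
  show ?thesis
  proof (rule Bochner_Integration.integrable_bound)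
    show "integrable lborel (\<lambda>y. C * norm (trunc t a (s - y)))" using i by auto
    show "AE x in lborel. norm (trunc t a (s - x) * trunc t c x) \<le> norm (C * norm (trunc t a (s - x)))"
      using C(1) by (intro AE_I2) (auto simp: norm_mult mult.commute intro!: mult_right_mono C(2))
  qed measurable
qed

lemma lconv_add_right:
  assumes "loc_integrable a" "continuous_on {0..} c" "continuous_on {0..} d"
  shows "lconv a (\<lambda>x. c x + d x) t = lconv a c t + lconv a d t"
proof -
  have "trunc t (\<lambda>x. c x + d x) y = trunc t c y + trunc t d y" for y
    by (simp add: trunc_def algebra_simps)
  then show ?thesis
    by (simp add: lconv_eq_trunc[OF order_refl] ring_distribs integrable_conv assms)
qed

lemma lconv_sum_right:
  assumes "loc_integrable a" "\<And>i. i \<in> I \<Longrightarrow> continuous_on {0..} (c i)"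
  shows "lconv a (\<lambda>x. \<Sum>i\<in>I. c i x) t = (\<Sum>i\<in>I. lconv a (c i) t)"
  using assms(2)
proof (induction I rule: infinite_finite_induct)
  case (insert i I)
  then show ?case
    by (simp add: lconv_add_right[OF assms(1)] continuous_on_sum)
qed (auto simp: lconv_def)

text \<open>Fubini after truncation at t. Since c is bounded on [0, t], the L^1 norms of the
  truncated a and b dominate the double integral, so both kernels may be singular at 0.\<close>

lemma lconv_assoc:
  assumes a: "loc_integrable a" and b: "loc_integrable b" and c: "continuous_on {0..} c"
  shows "lconv a (lconv b c) t = lconv (lconv a b) c t"
proof -
  obtain C where C: "C > 0" "\<And>x. norm (trunc t c x) \<le> C" using trunc_bounded[OF c] by blast
  have ia: "integrable lborel (\<lambda>y. trunc t a (t - y))"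
    using lborel_integrable_real_affine[OF integrable_trunc[OF a], of "-1" t t] by simp
  have ib: "integrable lborel (\<lambda>y. trunc t b (x - y))" for x
    using lborel_integrable_real_affine[OF integrable_trunc[OF b], of "-1" t x] by simp
  have mb [measurable]: "trunc t b \<in> borel_measurable borel"
    using borel_measurable_integrable[OF integrable_trunc[OF b]] by simp
  have ma [measurable]: "trunc t a \<in> borel_measurable borel"
    using borel_measurable_integrable[OF integrable_trunc[OF a]] by simp
  have mc [measurable]: "trunc t c \<in> borel_measurable borel" by (rule measurable_trunc[OF c])
  let ?f = "\<lambda>x z. trunc t a (t - x) * (trunc t b (x - z) * trunc t c z)"
  have bb: "(\<integral>z. norm (trunc t b (x - z)) \<partial>lborel) = (\<integral>z. norm (trunc t b z) \<partial>lborel)" for x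
    by (subst lborel_integral_real_affine[where c = "-1" and t = x]) auto
  have fub: "integrable (lborel \<Otimes>\<^sub>M lborel) (case_prod ?f)"
  proof (rule lborel_pair.Fubini_integrable)
    show "AE x in lborel. integrable lborel (\<lambda>y. case_prod ?f (x, y))"
      using integrable_conv[OF b c] by auto
    have "integrable lborel (\<lambda>x. \<integral>y. norm (?f x y) \<partial>lborel)"
    proof (rule Bochner_Integration.integrable_bound)
      show "integrable lborel (\<lambda>x. norm (trunc t a (t - x)) * ((\<integral>z. norm (trunc t b z) \<partial>lborel) * C))"
        using ia by auto
      have "norm (\<integral>y. norm (?f x y) \<partial>lborel) \<le>
         norm (norm (trunc t a (t - x)) * ((\<integral>z. norm (trunc t b z) \<partial>lborel) * C))" for x
      proof -
        have "norm (\<integral>y. norm (?f x y) \<partial>lborel) = (\<integral>y. norm (?f x y) \<partial>lborel)" by simp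
        also have "\<dots> \<le> (\<integral>y. norm (trunc t a (t - x)) * (norm (trunc t b (x - y)) * C) \<partial>lborel)"
        proof (rule integral_mono)
          show "integrable lborel (\<lambda>y. norm (?f x y))"
            using integrable_conv[OF b c] by auto
          show "integrable lborel (\<lambda>y. norm (trunc t a (t - x)) * (norm (trunc t b (x - y)) * C))"
            using ib[of x] by auto
        qed (auto simp: norm_mult intro!: mult_left_mono C)
        also have "\<dots> = norm (trunc t a (t - x)) * ((\<integral>z. norm (trunc t b z) \<partial>lborel) * C)"
          by (simp add: bb)
        finally show ?thesis by simp
      qed
      then show "AE x in lborel. norm (\<integral>y. norm (?f x y) \<partial>lborel) \<le>
         norm (norm (trunc t a (t - x)) * ((\<integral>z. norm (trunc t b z) \<partial>lborel) * C))" by simp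
    qed measurable
    then show "integrable lborel (\<lambda>x. \<integral>y. norm (case_prod ?f (x, y)) \<partial>lborel)" by simp
  qed measurable
  have "lconv a (lconv b c) t = (\<integral>x. \<integral>z. ?f x z \<partial>lborel \<partial>lborel)"
  proof -
    have "lconv a (lconv b c) t = (\<integral>x. trunc t a (t - x) * trunc t (lconv b c) x \<partial>lborel)"
      by (rule lconv_eq_trunc) simp
    also have "\<dots> = (\<integral>x. trunc t a (t - x) * lconv b c x \<partial>lborel)"
      by (intro Bochner_Integration.integral_cong refl)
         (auto simp: trunc_def indicator_def lconv_nonpos)
    also have "\<dots> = (\<integral>x. trunc t a (t - x) * (\<integral>z. trunc t b (x - z) * trunc t c z \<partial>lborel) \<partial>lborel)"
    proof (intro Bochner_Integration.integral_cong refl)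
      fix x
      show "trunc t a (t - x) * lconv b c x =
            trunc t a (t - x) * (\<integral>z. trunc t b (x - z) * trunc t c z \<partial>lborel)"
        by (cases "x \<le> t") (simp_all add: lconv_eq_trunc trunc_def)
    qed
    also have "\<dots> = (\<integral>x. \<integral>z. ?f x z \<partial>lborel \<partial>lborel)" by simp
    finally show ?thesis .
  qed
  also have "\<dots> = (\<integral>z. \<integral>x. ?f x z \<partial>lborel \<partial>lborel)"
    using lborel_pair.Fubini_integral[OF fub] by simp
  also have "\<dots> = (\<integral>z. trunc t (lconv a b) (t - z) * trunc t c z \<partial>lborel)"
  proof (intro Bochner_Integration.integral_cong refl)
    fix z
    have "(\<integral>x. ?f x z \<partial>lborel) = (\<integral>x. trunc t a (t - x) * trunc t b (x - z) * trunc t c z \<partial>lborel)"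
      by (simp add: mult.assoc)
    also have "\<dots> = (\<integral>x. trunc t a (t - x) * trunc t b (x - z) \<partial>lborel) * trunc t c z"
      by (rule integral_mult_left_zero)
    also have "(\<integral>x. trunc t a (t - x) * trunc t b (x - z) \<partial>lborel) =
       (\<integral>y. trunc t a ((t - z) - y) * trunc t b y \<partial>lborel)"
      by (subst lborel_integral_real_affine[where c = 1 and t = z]) (auto simp: algebra_simps)
    also have "\<dots> * trunc t c z = lconv a b (t - z) * trunc t c z"
      by (cases "0 \<le> z") (auto simp: trunc_def lconv_eq_trunc[of "t - z" t])
    also have "\<dots> = trunc t (lconv a b) (t - z) * trunc t c z"
      by (auto simp: trunc_def indicator_def)
    finally show "(\<integral>x. ?f x z \<partial>lborel) = trunc t (lconv a b) (t - z) * trunc t c z" .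
  qed
  also have "\<dots> = lconv (lconv a b) c t" by (rule lconv_eq_trunc[symmetric]) simp
  finally show ?thesis .
qed

text \<open>The kernel a is merely integrable, so commutativity moves the shift onto the continuous
  factor; dominated convergence then works on one interval [0, T] that contains the whole
  sequence.\<close>

lemma continuous_on_lconv:
  assumes a: "loc_integrable a" and c: "continuous_on {0..} c"
  shows "continuous_on {0..} (lconv a c)"
proof (rule continuous_on_sequentiallyI)
  fix s t assume s: "\<forall>n. s n \<in> {0..}" and t: "t \<in> {0::real..}" and lim: "s \<longlonglongrightarrow> t"
  have "bounded (range s)" using lim by (rule convergent_imp_bounded)
  then obtain T where T: "\<And>n. s n \<le> T" "0 < T"
  proof -
    from \<open>bounded (range s)\<close> obtain B where "B > 0" "\<forall>x\<in>range s. norm x \<le> B"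
      by (auto simp: bounded_pos)
    then have "s n \<le> B" for n using abs_ge_self[of "s n"] by (force intro: order_trans)
    with \<open>B > 0\<close> that show ?thesis by blast
  qed
  have tT: "t \<le> T" using lim T(1) by (intro LIMSEQ_le_const2[OF lim]) auto
  obtain C where C: "C > 0" "\<And>x. norm (trunc T c x) \<le> C" using trunc_bounded[OF c] by blast
  have cc: "continuous_on UNIV (\<lambda>x. c (max 0 x))" by (rule continuous_on_max0[OF c])
  then have [measurable]: "(\<lambda>x. c (max 0 x)) \<in> borel_measurable borel"
    by (rule borel_measurable_continuous_onI)
  note ia = integrable_trunc[OF a, of T]
  note [measurable] = borel_measurable_integrable[OF ia]
  let ?g = "\<lambda>s x. trunc T a x * (indicator {..s} x *\<^sub>R c (max 0 (s - x)))"
  have eq: "lconv a c r = (\<integral>x. ?g r x \<partial>lborel)" if "r \<le> T" for r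
  proof -
    have "lconv a c r = lconv c a r" by (rule lconv_commute)
    also have "\<dots> = (\<integral>x. ?g r x \<partial>lborel)"
      unfolding lconv_def set_lebesgue_integral_def trunc_def
      using that by (intro Bochner_Integration.integral_cong refl) (auto simp: indicator_def)
    finally show ?thesis .
  qed
  have "(\<lambda>n. \<integral>x. ?g (s n) x \<partial>lborel) \<longlonglongrightarrow> (\<integral>x. ?g t x \<partial>lborel)"
  proof (rule integral_dominated_convergence)
    show "integrable lborel (\<lambda>x. norm (trunc T a x) * C)" using ia by auto
    show "AE x in lborel. norm (?g (s n) x) \<le> norm (trunc T a x) * C" for n
    proof (rule AE_I2)
      fix x
      show "norm (?g (s n) x) \<le> norm (trunc T a x) * C"
      proof (cases "0 \<le> x \<and> x \<le> s n")
        case True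
        then have "norm (c (s n - x)) \<le> C"
          using C(2)[of "s n - x"] T(1)[of n] by (auto simp: trunc_def)
        then show ?thesis using True by (auto simp: norm_mult intro!: mult_left_mono)
      next
        case False
        then show ?thesis using C(1) by (auto simp: norm_mult trunc_def indicator_def)
      qed
    qed
    \<comment> \<open>At x = t the indicator of {..s n} may oscillate, so this single point is
      discarded.\<close>
    have "AE x in lborel. x \<noteq> t" by (rule AE_lborel_singleton)
    then show "AE x in lborel. (\<lambda>n. ?g (s n) x) \<longlonglongrightarrow> ?g t x"
    proof eventually_elim
      case (elim x)
      have 1: "(\<lambda>n. c (max 0 (s n - x))) \<longlonglongrightarrow> c (max 0 (t - x))"
        by (rule continuous_on_tendsto_compose[OF cc, where l = "t - x"]) (auto intro!: tendsto_intros lim)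
      have 2: "(\<lambda>n. indicator {..s n} x :: real) \<longlonglongrightarrow> indicator {..t} x"
      proof (cases "x < t")
        case True
        then have "\<forall>\<^sub>F n in sequentially. x < s n" using lim by (rule order_tendstoD(1)[rotated])
        then have "\<forall>\<^sub>F n in sequentially. (indicator {..s n} x :: real) = indicator {..t} x"
          by eventually_elim (use True in auto)
        then show ?thesis by (rule tendsto_eventually)
      next
        case False
        with elim have "t < x" by simp
        then have "\<forall>\<^sub>F n in sequentially. s n < x" using lim by (rule order_tendstoD(2)[rotated])
        then have "\<forall>\<^sub>F n in sequentially. (indicator {..s n} x :: real) = indicator {..t} x"
          by eventually_elim (use \<open>t < x\<close> in auto)
        then show ?thesis by (rule tendsto_eventually)
      qed
      show ?case by (intro tendsto_intros 1 2)
    qed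
  qed measurable
  then show "(\<lambda>n. lconv a c (s n)) \<longlonglongrightarrow> lconv a c t"
    using eq T(1) tT by simp
qed

lemma lconv_one_has_derivative:
  assumes c: "continuous_on {0..} c" and t: "0 < t"
  shows "(lconv (\<lambda>_. 1) c has_vector_derivative c t) (at t)"
proof -
  have c': "continuous_on {0..t+1} c" by (rule continuous_on_subset[OF c]) auto
  have "((\<lambda>u. integral {0..u} c) has_vector_derivative c t) (at t within {0..t+1})"
    by (rule integral_has_vector_derivative[OF c']) (use t in auto)
  then have "((\<lambda>u. integral {0..u} c) has_vector_derivative c t) (at t)"
    using t by (simp add: at_within_Icc_at)
  moreover have "integral {0..u} c = lconv (\<lambda>_. 1) c u" if "u \<in> {0<..}" for u
    unfolding lconv_def using set_borel_integral_eq_integral(2)[of "{0..u}" c]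
      loc_integrable_continuous[OF c] by (simp add: loc_integrable_def)
  ultimately show ?thesis
    using has_vector_derivative_transform_within_open[of "\<lambda>u. integral {0..u} c" "c t" t "{0<..}" "lconv (\<lambda>_. 1) c"] t
    by simp
qed

text \<open>The majorant is a complex function read through its real part. The bound is then again
  an \<open>lconv\<close>, which the convolution law evaluates in closed form.\<close>

lemma norm_lconv_le:
  assumes "loc_integrable a" "continuous_on {0..} c" "\<And>x. 0 \<le> x \<Longrightarrow> x \<le> t \<Longrightarrow> norm (c x) \<le> C"
    "loc_integrable a'" "\<And>x. 0 \<le> x \<Longrightarrow> x \<le> t \<Longrightarrow> norm (a x) \<le> Re (a' x)"
  shows "norm (lconv a c t) \<le> C * Re (lconv a' (\<lambda>_. 1) t)"
proof (cases "t \<le> 0")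
  case True
  then show ?thesis by (simp add: lconv_nonpos)
next
  case False
  then have C: "0 \<le> C" using assms(3)[of 0] norm_ge_zero[of "c 0"] by linarith
  let ?h = "\<lambda>y. trunc t a' (t - y) * trunc t (\<lambda>_. 1) y"
  have i: "integrable lborel ?h" by (rule integrable_conv[OF assms(4)]) auto
  have "norm (lconv a c t) = norm (\<integral>y. trunc t a (t - y) * trunc t c y \<partial>lborel)"
    by (simp add: lconv_eq_trunc[OF order_refl])
  also have "\<dots> \<le> (\<integral>y. C * Re (?h y) \<partial>lborel)"
  proof (rule Bochner_Integration.integral_norm_bound_integral)
    show "integrable lborel (\<lambda>y. trunc t a (t - y) * trunc t c y)"
      by (rule integrable_conv[OF assms(1,2)])
    show "integrable lborel (\<lambda>y. C * Re (?h y))"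
      by (intro integrable_mult_right integrable_Re i)
  next
    fix y
    have "norm (a (t - y)) * norm (c y) \<le> Re (a' (t - y)) * C" if "0 \<le> y" "y \<le> t"
      using that by (intro mult_mono assms(3,5)) (auto intro: order_trans[OF norm_ge_zero assms(5)])
    then show "norm (trunc t a (t - y) * trunc t c y) \<le> C * Re (?h y)"
      using False by (auto simp: trunc_def indicator_def norm_mult mult.commute)
  qed
  also have "\<dots> = C * Re (lconv a' (\<lambda>_. 1) t)"
    by (subst lconv_eq_trunc[OF order_refl]) (simp only: integral_mult_right_zero integral_Re[OF i])
  finally show ?thesis .
qed

subsection \<open>Fractional integration kernels\<close>

text \<open>The power t^(s-1), set to 0 for t \<le> 0 so that integrals over the line need no
  indicator. Using \<open>exp\<close> and the real \<open>ln\<close> avoids the principal power at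
  negative arguments.\<close>

definition pos_pow :: "complex \<Rightarrow> real \<Rightarrow> complex" where
  "pos_pow s t = (if t \<le> 0 then 0 else exp ((s - 1) * of_real (ln t)))"

lemma pos_pow_eq_powr: "0 < t \<Longrightarrow> pos_pow s t = of_real t powr (s - 1)"
  by (simp add: pos_pow_def powr_def Ln_of_real)

lemma pos_pow_of_real: "0 < t \<Longrightarrow> pos_pow (of_real s) t = of_real (t powr (s - 1))"
  using powr_of_real[of t "s - 1"] by (simp add: pos_pow_eq_powr)

lemma pos_pow_nonpos: "t \<le> 0 \<Longrightarrow> pos_pow s t = 0"
  by (simp add: pos_pow_def)

lemma norm_pos_pow: "0 < t \<Longrightarrow> norm (pos_pow s t) = t powr (Re s - 1)"
  by (simp add: pos_pow_def powr_def)

lemma norm_pos_pow_eq: "pos_pow (of_real (Re s)) t = of_real (norm (pos_pow s t))"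
  by (cases "0 < t") (simp_all add: norm_pos_pow pos_pow_of_real pos_pow_nonpos)

lemma measurable_pos_pow [measurable]: "pos_pow s \<in> borel_measurable borel"
  unfolding pos_pow_def[abs_def] by measurable

lemma loc_integrable_bound:
  assumes "loc_integrable a" "b \<in> borel_measurable borel"
    "\<And>T. \<exists>C. \<forall>x. 0 \<le> x \<longrightarrow> x \<le> T \<longrightarrow> norm (b x) \<le> C * norm (a x)"
  shows "loc_integrable b"
  unfolding loc_integrable_def
proof
  fix T
  obtain C where C: "\<And>x. 0 \<le> x \<Longrightarrow> x \<le> T \<Longrightarrow> norm (b x) \<le> C * norm (a x)"
    using assms(3)[of T] by blast
  have i: "integrable lborel (\<lambda>x. norm (C *\<^sub>R (indicator {0..T} x *\<^sub>R a x)))"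
    using assms(1) unfolding loc_integrable_def set_integrable_def
    by (intro integrable_norm integrable_scaleR_right) blast
  note [measurable] = assms(2)
  show "set_integrable lborel {0..T} b"
    unfolding set_integrable_def
    by (rule Bochner_Integration.integrable_bound[OF i])
       (auto simp: indicator_def intro!: AE_I2 order_trans[OF C] mult_right_mono)
qed

lemma loc_integrable_powr:
  assumes "0 < r" shows "loc_integrable (\<lambda>t. of_real (t powr (r - 1)))"
  unfolding loc_integrable_def
proof
  fix T :: real
  have "(\<lambda>t. t powr (r - 1)) integrable_on {0..T}"
    using assms by (cases "0 \<le> T") (auto intro: integrable_on_powr_from_0)
  then have "(\<lambda>t. t powr (r - 1)) absolutely_integrable_on {0..T}"
    by (intro nonnegative_absolutely_integrable_1) auto
  then have "integrable lebesgue (\<lambda>t. indicator {0..T} t *\<^sub>R (t powr (r - 1)))"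
    unfolding set_integrable_def .
  then have "integrable lborel (\<lambda>t. indicator {0..T} t *\<^sub>R (t powr (r - 1)))"
    by (subst (asm) integrable_completion) auto
  then have "integrable lborel (\<lambda>t. complex_of_real (indicator {0..T} t *\<^sub>R (t powr (r - 1))))"
    by (rule integrable_of_real)
  then show "set_integrable lborel {0..T} (\<lambda>t. complex_of_real (t powr (r - 1)))"
    unfolding set_integrable_def by (simp add: scaleR_conv_of_real)
qed

lemma loc_integrable_pos_pow:
  assumes "0 < Re s" shows "loc_integrable (pos_pow s)"
proof (rule loc_integrable_bound[OF loc_integrable_powr[OF assms] measurable_pos_pow])
  fix T
  have "norm (pos_pow s x) \<le> 1 * norm (complex_of_real (x powr (Re s - 1)))" for x
    by (cases "0 < x") (simp_all add: norm_pos_pow pos_pow_nonpos)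
  then show "\<exists>C. \<forall>x. 0 \<le> x \<longrightarrow> x \<le> T \<longrightarrow> norm (pos_pow s x) \<le> C * norm (complex_of_real (x powr (Re s - 1)))"
    by blast
qed

lemma Gamma_nonzero_Re_pos: "0 < Re s \<Longrightarrow> Gamma (s :: complex) \<noteq> 0"
  by (auto simp: Gamma_eq_zero_iff elim!: nonpos_Ints_cases)

lemma Gamma_has_bochner_integral:
  assumes "0 < Re s"
  shows "has_bochner_integral lborel (\<lambda>t. pos_pow s t * of_real (exp (- t))) (Gamma s)"
proof -
  have eq: "(\<lambda>t. indicator {0<..} t *\<^sub>R (complex_of_real t powr (s - 1) / of_real (exp t))) =
     (\<lambda>t. pos_pow s t * of_real (exp (- t)))"
    by (auto simp: fun_eq_iff indicator_def pos_pow_nonpos pos_pow_eq_powr exp_minus field_simps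
             simp flip: of_real_inverse)
  have ai: "(\<lambda>t. complex_of_real t powr (s - 1) / of_real (exp t)) absolutely_integrable_on {0<..}"
    by (rule absolutely_integrable_Gamma_integral'[OF assms])
  then have i: "integrable lebesgue (\<lambda>t. pos_pow s t * of_real (exp (- t)))"
    unfolding set_integrable_def eq .
  have "(LINT t:{0<..}|lebesgue. complex_of_real t powr (s - 1) / of_real (exp t)) = Gamma s"
    using set_lebesgue_integral_eq_integral(2)[OF ai] Gamma_integral_complex'[OF assms]
    by (simp add: integral_unique)
  then have "(\<integral>t. pos_pow s t * of_real (exp (- t)) \<partial>lebesgue) = Gamma s"
    unfolding set_lebesgue_integral_def eq .
  then show ?thesis
    using i by (simp add: has_bochner_integral_iff integrable_completion integral_completion)
qed

lemma pos_pow_mult: "0 < c \<Longrightarrow> pos_pow s (c * t) = pos_pow s c * pos_pow s t"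
  by (cases "0 < t") (auto simp: pos_pow_def ln_mult algebra_simps mult_le_0_iff simp flip: exp_add)

lemma pos_pow_add: "pos_pow s t * pos_pow r t * of_real t = pos_pow (s + r) t"
proof (cases "0 < t")
  case True
  have "pos_pow s t * pos_pow r t * of_real t = exp ((s - 1) * of_real (ln t)) * exp ((r - 1) * of_real (ln t)) * exp (of_real (ln t))"
    using True by (simp add: pos_pow_def exp_of_real)
  also have "\<dots> = pos_pow (s + r) t" using True by (simp add: pos_pow_def algebra_simps flip: exp_add)
  finally show ?thesis .
qed (simp add: pos_pow_nonpos)

lemma lconv_pos_pow_scale:
  assumes "0 < t"
  shows "lconv (pos_pow a) (pos_pow b) t = pos_pow (a + b) t * lconv (pos_pow a) (pos_pow b) 1"
proof -
  have "lconv (pos_pow a) (pos_pow b) t = \<bar>t\<bar> *\<^sub>R (\<integral>u. indicator {0..t} (0 + t * u) *\<^sub>R (pos_pow a (t - (0 + t * u)) * pos_pow b (0 + t * u)) \<partial>lborel)"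
    unfolding lconv_def set_lebesgue_integral_def
    by (rule lborel_integral_real_affine) (use assms in simp)
  also have "(\<lambda>u. indicator {0..t} (0 + t * u) *\<^sub>R (pos_pow a (t - (0 + t * u)) * pos_pow b (0 + t * u))) =
     (\<lambda>u. pos_pow a t * pos_pow b t * (indicator {0..1} u *\<^sub>R (pos_pow a (1 - u) * pos_pow b u)))"
  proof
    fix u
    have "pos_pow a (t - t * u) = pos_pow a t * pos_pow a (1 - u)"
      using pos_pow_mult[OF assms, of a "1 - u"] by (simp add: algebra_simps)
    then show "indicator {0..t} (0 + t * u) *\<^sub>R (pos_pow a (t - (0 + t * u)) * pos_pow b (0 + t * u)) =
      pos_pow a t * pos_pow b t * (indicator {0..1} u *\<^sub>R (pos_pow a (1 - u) * pos_pow b u))"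
      using assms by (auto simp: indicator_def pos_pow_mult zero_le_mult_iff)
  qed
  also have "(\<integral>u. pos_pow a t * pos_pow b t * (indicator {0..1} u *\<^sub>R (pos_pow a (1 - u) * pos_pow b u)) \<partial>lborel) =
      pos_pow a t * pos_pow b t * lconv (pos_pow a) (pos_pow b) 1"
    unfolding lconv_def set_lebesgue_integral_def by (rule integral_mult_right_zero)
  finally show ?thesis using assms by (simp add: scaleR_conv_of_real mult_ac flip: pos_pow_add)
qed

text \<open>Euler's relation between the Beta and Gamma functions. With the weights exp(-t)
  attached, the double integral factors into Gamma a * Gamma b in one order; in the other order the
  weights combine to exp(-s), and homogeneity of the inner convolution leaves the integral for Gamma
  (a + b).\<close>

lemma lconv_pos_pow_1:
  assumes a: "0 < Re a" and b: "0 < Re b"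
  shows "lconv (pos_pow a) (pos_pow b) 1 * Gamma (a + b) = Gamma a * Gamma b"
proof -
  let ?E = "\<lambda>s t. pos_pow s t * of_real (exp (- t))"
  have iE: "integrable lborel (?E s)" "(\<integral>t. ?E s t \<partial>lborel) = Gamma s" if "0 < Re s" for s
    using Gamma_has_bochner_integral[OF that] by (simp_all add: has_bochner_integral_iff)
  let ?f = "\<lambda>y s. ?E a (s - y) * ?E b y"
  have shift: "integrable lborel (\<lambda>s. ?E a (s - y))" "(\<integral>s. ?E a (s - y) \<partial>lborel) = Gamma a"
    "(\<integral>s. norm (?E a (s - y)) \<partial>lborel) = (\<integral>s. norm (?E a s) \<partial>lborel)" for y
  proof -
    show "integrable lborel (\<lambda>s. ?E a (s - y))"
      using lborel_integrable_real_affine[OF iE(1)[OF a], of 1 "- y"] by simp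
    show "(\<integral>s. ?E a (s - y) \<partial>lborel) = Gamma a"
      using lborel_integral_real_affine[of 1 "?E a" "- y"] iE(2)[OF a] by simp
    show "(\<integral>s. norm (?E a (s - y)) \<partial>lborel) = (\<integral>s. norm (?E a s) \<partial>lborel)"
      using lborel_integral_real_affine[of 1 "\<lambda>s. norm (?E a s)" "- y"] by simp
  qed
  have fub: "integrable (lborel \<Otimes>\<^sub>M lborel) (case_prod ?f)"
  proof (rule lborel_pair.Fubini_integrable)
    show "AE y in lborel. integrable lborel (\<lambda>s. case_prod ?f (y, s))"
      using shift(1) by simp
    have "(\<integral>s. norm (?f y s) \<partial>lborel) = (\<integral>s. norm (?E a s) \<partial>lborel) * norm (?E b y)" for y
      by (subst shift(3)[symmetric, of y], subst norm_mult, rule integral_mult_left_zero)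
    then show "integrable lborel (\<lambda>y. \<integral>s. norm (case_prod ?f (y, s)) \<partial>lborel)"
      using integrable_norm[OF iE(1)[OF b]] by (simp del: norm_mult)
  qed measurable
  have "Gamma a * Gamma b = (\<integral>y. Gamma a * ?E b y \<partial>lborel)"
    using iE(2)[OF b] by (subst integral_mult_right_zero) simp
  also have "\<dots> = (\<integral>y. \<integral>s. ?f y s \<partial>lborel \<partial>lborel)"
    by (subst integral_mult_left_zero) (simp only: shift(2))
  also have "\<dots> = (\<integral>s. \<integral>y. ?f y s \<partial>lborel \<partial>lborel)"
    using lborel_pair.Fubini_integral[OF fub] by simp
  also have "\<dots> = (\<integral>s. lconv (pos_pow a) (pos_pow b) 1 * ?E (a + b) s \<partial>lborel)"
  proof (intro Bochner_Integration.integral_cong refl)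
    fix s
    have "(\<integral>y. ?f y s \<partial>lborel) = (\<integral>y. of_real (exp (- s)) * (indicator {0..s} y *\<^sub>R (pos_pow a (s - y) * pos_pow b y)) \<partial>lborel)"
      by (intro Bochner_Integration.integral_cong refl)
         (auto simp: indicator_def pos_pow_nonpos exp_minus exp_diff field_simps)
    also have "\<dots> = of_real (exp (- s)) * lconv (pos_pow a) (pos_pow b) s"
      unfolding lconv_def set_lebesgue_integral_def by (rule integral_mult_right_zero)
    also have "\<dots> = lconv (pos_pow a) (pos_pow b) 1 * ?E (a + b) s"
      by (cases "0 < s") (simp_all add: lconv_pos_pow_scale[of s] lconv_nonpos pos_pow_nonpos)
    finally show "(\<integral>y. ?f y s \<partial>lborel) = lconv (pos_pow a) (pos_pow b) 1 * ?E (a + b) s" .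
  qed
  also have "\<dots> = lconv (pos_pow a) (pos_pow b) 1 * Gamma (a + b)"
    using iE(2)[of "a + b"] a b by (subst integral_mult_right_zero) simp
  finally show ?thesis by simp
qed

text \<open>The kernel of fractional integration of order s. The Gamma factor turns the Beta
  integral into the semigroup law \<open>lconv_rl_kernel\<close>.\<close>

definition rl_kernel :: "complex \<Rightarrow> real \<Rightarrow> complex" where
  "rl_kernel s t = pos_pow s t / Gamma s"

lemma rl_kernel_nonpos: "t \<le> 0 \<Longrightarrow> rl_kernel s t = 0"
  by (simp add: rl_kernel_def pos_pow_nonpos)

lemma rl_kernel_1: "0 < t \<Longrightarrow> rl_kernel 1 t = 1"
  by (simp add: rl_kernel_def pos_pow_eq_powr)

lemma loc_integrable_rl_kernel: "0 < Re s \<Longrightarrow> loc_integrable (rl_kernel s)"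
  unfolding rl_kernel_def[abs_def]
  by (rule loc_integrable_bound[OF loc_integrable_pos_pow])
     (auto simp: norm_divide intro!: exI[of _ "1 / norm (Gamma s)"])

lemma lconv_rl_kernel:
  assumes a: "0 < Re a" and b: "0 < Re b"
  shows "lconv (rl_kernel a) (rl_kernel b) t = rl_kernel (a + b) t"
proof (cases "0 < t")
  case True
  have *: "lconv (rl_kernel a) (rl_kernel b) t = 1 / Gamma a * (1 / Gamma b * lconv (pos_pow a) (pos_pow b) t)"
  proof -
    have "lconv (rl_kernel a) (rl_kernel b) t = lconv (\<lambda>x. 1 / Gamma a * pos_pow a x) (\<lambda>x. 1 / Gamma b * pos_pow b x) t"
      by (simp add: rl_kernel_def[abs_def])
    then show ?thesis by (simp only: lconv_scale_left lconv_scale_right)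
  qed
  have "lconv (pos_pow a) (pos_pow b) 1 = Gamma a * Gamma b / Gamma (a + b)"
    using lconv_pos_pow_1[OF a b] Gamma_nonzero_Re_pos[of "a + b"] a b by (simp add: field_simps)
  then show ?thesis
    using Gamma_nonzero_Re_pos[of "a"] Gamma_nonzero_Re_pos[of b] a b
    by (simp add: * lconv_pos_pow_scale[OF True] rl_kernel_def)
qed (simp add: lconv_nonpos rl_kernel_nonpos)

text \<open>Comparing the Beta integrals with first parameters \<open>z\<close> and \<open>Re z\<close> reduces the convergence of all series with
  complex parameters to real ones.\<close>

lemma rGamma_shift_bound:
  assumes z: "0 < Re z" and b: "0 \<le> b"
  shows "norm (1 / Gamma (z + of_real b)) \<le> Gamma (Re z) / norm (Gamma z) / Gamma (Re z + b)"
\<comment> \<open>At b = 0 the Beta integral diverges, but the claimed bound is then an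
  equality.\<close>
proof (cases "b = 0")
  case True
  then show ?thesis using Gamma_real_pos[OF z] by (simp add: norm_divide)
next
  case False
  then have b: "0 < b" using b by simp
  let ?B = "\<lambda>z. lconv (pos_pow z) (pos_pow (of_real b)) 1"
  have B: "?B z = Gamma z * Gamma (of_real b) / Gamma (z + of_real b)" if "0 < Re z" for z
    using lconv_pos_pow_1[of z "of_real b"] Gamma_nonzero_Re_pos[of "z + of_real b"] that b by (simp add: field_simps)
  have "?B (of_real (Re z)) = (\<integral>y. of_real (norm (indicator {0..1} y *\<^sub>R (pos_pow z (1 - y) * pos_pow (of_real b) y))) \<partial>lborel)"
    unfolding lconv_def set_lebesgue_integral_def
    by (intro Bochner_Integration.integral_cong refl)
       (auto simp: norm_pos_pow_eq norm_mult indicator_def norm_pos_pow_eq[of "of_real b", simplified, symmetric])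
  also have "\<dots> = of_real (\<integral>y. norm (indicator {0..1} y *\<^sub>R (pos_pow z (1 - y) * pos_pow (of_real b) y)) \<partial>lborel)"
    by (rule integral_complex_of_real)
  finally have "norm (?B z) \<le> Re (?B (of_real (Re z)))"
    unfolding lconv_def set_lebesgue_integral_def
    by (simp only: Re_complex_of_real integral_norm_bound)
  also have "?B (of_real (Re z)) = of_real (Gamma (Re z) * Gamma b / Gamma (Re z + b))"
    using B[of "of_real (Re z)"] z by (simp add: Gamma_complex_of_real flip: of_real_add)
  finally have "norm (Gamma z) * Gamma b / norm (Gamma (z + of_real b)) \<le> Gamma (Re z) * Gamma b / Gamma (Re z + b)"
    using Gamma_real_pos[OF b] by (simp add: B z norm_mult norm_divide Gamma_complex_of_real)
  then have "norm (Gamma z) * Gamma b / norm (Gamma (z + of_real b)) / (norm (Gamma z) * Gamma b) \<le>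
      Gamma (Re z) * Gamma b / Gamma (Re z + b) / (norm (Gamma z) * Gamma b)"
    using Gamma_real_pos[OF b] by (intro divide_right_mono) auto
  then show ?thesis
    using Gamma_real_pos[OF b] Gamma_nonzero_Re_pos[OF z] by (simp add: norm_divide mult.commute)
qed

section \<open>Growth of the Gamma function and convergence of the kernel series\<close>

text \<open>Only the part of Euler's integral over [R, \<infinity>) is kept; there t^(y-1) is at
  least R^(y-1) because y \<ge> 1.\<close>

lemma Gamma_lower_bound_ge1:
  assumes y: "1 \<le> y" and R: "0 < R"
  shows "R powr (y - 1) * exp (- R) \<le> Gamma (y :: real)"
proof (rule has_integral_le)
  have "((\<lambda>t. R powr (y - 1) * exp (- 1 * t)) has_integral R powr (y - 1) * (exp (- 1 * R) / 1)) {R..}"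
    by (intro has_integral_mult_right has_integral_exp_minus_to_infinity) simp
  then have "((\<lambda>t. R powr (y - 1) * exp (- t)) has_integral R powr (y - 1) * exp (- R)) {R..}" by simp
  then show "((\<lambda>t. if t \<in> {R..} then R powr (y - 1) * exp (- t) else 0) has_integral R powr (y - 1) * exp (- R)) {0..}"
    by (subst has_integral_restrict) (use R in auto)
  show "((\<lambda>t. t powr (y - 1) / exp t) has_integral Gamma y) {0..}"
    by (rule Gamma_integral_real) (use y in simp)
  show "(if t \<in> {R..} then R powr (y - 1) * exp (- t) else 0) \<le> t powr (y - 1) / exp t" if "t \<in> {0..}" for t
    using y R by (auto simp: exp_minus field_simps intro!: powr_mono2)
qed

text \<open>R remains free, so 1 / Gamma beats every geometric rate. For y < 1 the recurrence Gamma
  (1 + y) = y Gamma y leads back to arguments above 1; the factor R on the right makes one formula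
  serve both cases.\<close>

lemma rGamma_le:
  assumes y: "0 < y" and R: "1 \<le> R"
  shows "1 / Gamma (y :: real) \<le> R * exp R * R powr (- y)"
proof -
  have 1: "1 / Gamma y \<le> exp R * R powr (1 - y)" if "1 \<le> y" for y :: real
  proof -
    have "1 / Gamma y \<le> 1 / (R powr (y - 1) * exp (- R))"
      using Gamma_lower_bound_ge1[OF that, of R] R
      by (intro divide_left_mono mult_pos_pos) (use that in \<open>auto intro: Gamma_real_pos\<close>)
    also have "\<dots> = exp R * R powr (1 - y)"
      by (simp add: powr_diff exp_minus field_simps)
    finally show ?thesis .
  qed
  show ?thesis
  proof (cases "1 \<le> y")
    case True
    then show ?thesis using 1[OF True] R by (simp add: powr_diff powr_minus field_simps)
  next
    case False
    have "1 / Gamma y = y * (1 / Gamma (1 + y))"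
      using y by (subst Gamma_plus1[of y, simplified add.commute]) (auto elim!: nonpos_Ints_cases)
    also have "\<dots> \<le> 1 * (exp R * R powr (1 - (1 + y)))"
      using y False by (intro mult_mono 1) (auto intro: Gamma_real_pos less_imp_le)
    also have "\<dots> \<le> R * exp R * R powr (- y)"
      using R by simp
    finally show ?thesis .
  qed
qed

lemma powr_div_Gamma_le:
  assumes "0 < y" "1 \<le> R" "0 < (t :: real)"
  shows "t powr (y - 1) / Gamma y \<le> (R * exp R / t) * (t / R) powr y"
proof -
  have "t powr (y - 1) * (1 / Gamma y) \<le> t powr (y - 1) * (R * exp R * R powr (- y))"
    by (rule mult_left_mono[OF rGamma_le[OF assms(1,2)]]) simp
  also have "\<dots> = (R * exp R / t) * (t / R) powr y"
    using assms by (simp add: powr_diff powr_divide powr_minus field_simps)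
  finally show ?thesis by simp
qed

text \<open>Used to choose R in the previous bounds: it makes the ratio of a geometric comparison
  series as small as desired.\<close>

lemma eventually_scaled_powr_small:
  assumes "0 < a" "0 < t" "0 < e"
  shows "\<forall>\<^sub>F R in at_top. x * (t / R) powr a < (e :: real)"
proof -
  have "((\<lambda>R. x * (t / R) powr a) \<longlongrightarrow> x * 0) at_top"
  proof (intro tendsto_intros)
    have 1: "((\<lambda>R. t / R) \<longlongrightarrow> 0) at_top"
      by (intro tendsto_divide_0[OF tendsto_const] filterlim_at_top_imp_at_infinity filterlim_ident)
    have 2: "\<forall>\<^sub>F R in at_top. 0 \<le> t / R"
      using eventually_gt_at_top[of 0] by eventually_elim (use assms in simp)
    show "((\<lambda>R. (t / R) powr a) \<longlongrightarrow> 0) at_top"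
      using tendsto_powr'[OF 1 tendsto_const[of a]] 2 assms by simp
  qed
  from order_tendstoD(2)[OF this, of e] assms show ?thesis by simp
qed

lemma summable_ml:
  fixes s a x t :: real
  assumes s: "0 < s" and a: "0 < a" and x: "0 \<le> x"
  shows "summable (\<lambda>n. x ^ n * norm (rl_kernel (of_real (s + a * real n)) t))"
proof (cases "0 < t")
  case t: True
  have "\<forall>\<^sub>F R in at_top. x * (t / R) powr a < 1 \<and> 1 \<le> R"
    using eventually_scaled_powr_small[OF a t, of 1 x] eventually_ge_at_top[of 1]
    by (auto intro: eventually_conj)
  then obtain R where R: "x * (t / R) powr a < 1" "1 \<le> R" using eventually_happens' by force
  define C where "C = (R * exp R / t) * (t / R) powr s"
  have sp: "0 < s + a * real n" for n using s a by (simp add: add_pos_nonneg)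
  have n: "norm (rl_kernel (of_real (s + a * real n)) t) = t powr (s + a * real n - 1) / Gamma (s + a * real n)" for n
    using Gamma_real_pos[OF sp[of n]] t
    unfolding rl_kernel_def pos_pow_of_real[OF t] Gamma_complex_of_real by (simp add: norm_divide)
  have le: "norm (x ^ n * norm (rl_kernel (of_real (s + a * real n)) t)) \<le> C * (x * (t / R) powr a) ^ n" for n
  proof -
    have "norm (rl_kernel (of_real (s + a * real n)) t) \<le> (R * exp R / t) * (t / R) powr (s + a * real n)"
      unfolding n by (rule powr_div_Gamma_le[OF sp R(2) t])
    also have "\<dots> = C * ((t / R) powr a) ^ n"
      using t R(2) by (simp add: C_def powr_add powr_powr flip: powr_realpow)
    finally have "x ^ n * norm (rl_kernel (of_real (s + a * real n)) t) \<le> x ^ n * (C * ((t / R) powr a) ^ n)"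
      using x by (intro mult_left_mono) auto
    then show ?thesis using x by (simp add: power_mult_distrib mult_ac)
  qed
  have "summable (\<lambda>n. C * (x * (t / R) powr a) ^ n)"
    using R x t by (intro summable_mult summable_geometric) auto
  then show ?thesis by (rule summable_comparison_test'[OF _ le])
qed (simp add: rl_kernel_nonpos)

subsection \<open>Prabhakar kernels\<close>

text \<open>The coefficient of z^r in (1 - w z)^(-c). Multiplying two such series adds the
  exponents, which is the content of \<open>ml_coeff_convolution\<close>.\<close>

definition ml_coeff :: "real \<Rightarrow> complex \<Rightarrow> nat \<Rightarrow> complex" where
  "ml_coeff w c r = pochhammer c r * of_real w ^ r / fact r"

text \<open>The kernel k of the overview, expanded in Riemann-Liouville kernels so that convolutions
  can be computed term by term. Formally its Laplace transform is s^(-\<mu>) (1 - w s^(-a))^(-c),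
  which predicts the convolution law.\<close>

definition ml_kernel :: "real \<Rightarrow> real \<Rightarrow> complex \<Rightarrow> complex \<Rightarrow> real \<Rightarrow> complex" where
  "ml_kernel a w c \<mu> t = (\<Sum>r. ml_coeff w c r * rl_kernel (\<mu> + of_real (a * real r)) t)"

text \<open>Consecutive coefficients have quotient (c + r) w / (r + 1), whose modulus is at most (1
  + norm c) times that of w.\<close>

lemma norm_ml_coeff_le: "norm (ml_coeff w c r) \<le> ((1 + norm c) * \<bar>w\<bar>) ^ r"
proof (induction r)
  case (Suc r)
  have "norm ((c + of_nat r) * of_real w / of_nat (Suc r)) \<le> (1 + norm c) * \<bar>w\<bar>"
  proof -
    have "norm (c + of_nat r) \<le> norm c + real r"
      using norm_triangle_ineq[of c "of_nat r"] by simp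
    also have "\<dots> \<le> (1 + norm c) * real (Suc r)" by (simp add: algebra_simps)
    finally have "norm (c + of_nat r) / real (Suc r) \<le> 1 + norm c"
      by (simp add: divide_le_eq)
    then have "norm (c + of_nat r) / real (Suc r) * \<bar>w\<bar> \<le> (1 + norm c) * \<bar>w\<bar>"
      by (intro mult_right_mono) auto
    then show ?thesis by (simp add: norm_mult norm_divide del: of_nat_Suc)
  qed
  then have "norm (ml_coeff w c r) * norm ((c + of_nat r) * of_real w / of_nat (Suc r)) \<le>
     ((1 + norm c) * \<bar>w\<bar>) ^ r * ((1 + norm c) * \<bar>w\<bar>)"
    using Suc by (intro mult_mono) auto
  moreover have "ml_coeff w c (Suc r) = ml_coeff w c r * ((c + of_nat r) * of_real w / of_nat (Suc r))"
    by (simp add: ml_coeff_def pochhammer_Suc mult_ac)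
  ultimately show ?case by (simp only: norm_mult power_Suc2)
qed (simp add: ml_coeff_def)

lemma power_diff_split: "i \<le> n \<Longrightarrow> x ^ n = x ^ i * (x :: 'a :: monoid_mult) ^ (n - i)"
  by (simp flip: power_add)

lemma ml_coeff_convolution:
  "(\<Sum>i\<le>n. ml_coeff w c i * ml_coeff w d (n - i)) = ml_coeff w (c + d) n"
proof -
  have "ml_coeff w (c + d) n = (\<Sum>i\<le>n. of_nat (n choose i) * pochhammer c i * pochhammer d (n - i) * of_real w ^ n / fact n)"
    by (simp add: ml_coeff_def pochhammer_binomial_sum sum_distrib_right sum_divide_distrib)
  also have "\<dots> = (\<Sum>i\<le>n. ml_coeff w c i * ml_coeff w d (n - i))"
    by (intro sum.cong refl)
       (simp add: ml_coeff_def binomial_fact power_diff_split)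
  finally show ?thesis by simp
qed

lemma rl_kernel_of_real: "0 < s \<Longrightarrow> rl_kernel (of_real s) t = of_real (norm (rl_kernel (of_real s) t))"
  using norm_pos_pow_eq[of "of_real s" t] Gamma_real_pos[of s]
  by (simp add: rl_kernel_def Gamma_complex_of_real norm_divide)

text \<open>The constant does not depend on \<open>b\<close>, so a whole series with complex \<mu>
  is compared with the one for Re \<mu> at once.\<close>

lemma norm_rl_kernel_shift_le:
  assumes "0 < Re \<mu>" "0 \<le> b"
  shows "norm (rl_kernel (\<mu> + of_real b) t) \<le>
    Gamma (Re \<mu>) / norm (Gamma \<mu>) * norm (rl_kernel (of_real (Re \<mu> + b)) t)"
proof (cases "0 < t")
  case True
  have "t powr (Re \<mu> + b - 1) * norm (1 / Gamma (\<mu> + of_real b)) \<le>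
     t powr (Re \<mu> + b - 1) * (Gamma (Re \<mu>) / norm (Gamma \<mu>) / Gamma (Re \<mu> + b))"
    by (intro mult_left_mono rGamma_shift_bound assms) auto
  moreover have "norm (rl_kernel (of_real (Re \<mu> + b)) t) = t powr (Re \<mu> + b - 1) / Gamma (Re \<mu> + b)"
    using Gamma_real_pos[of "Re \<mu> + b"] assms True
    unfolding rl_kernel_def norm_divide Gamma_complex_of_real by (simp add: norm_pos_pow)
  ultimately show ?thesis using True by (simp add: rl_kernel_def norm_pos_pow norm_divide mult_ac)
qed (simp add: rl_kernel_nonpos)

lemma summable_rl_kernel_shift:
  assumes "0 < Re \<mu>" "0 < a" "0 \<le> X"
  shows "summable (\<lambda>r. X ^ r * norm (rl_kernel (\<mu> + of_real (a * real r)) t))"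
proof (rule summable_comparison_test')
  let ?K = "Gamma (Re \<mu>) / norm (Gamma \<mu>)"
  show "summable (\<lambda>r. ?K * (X ^ r * norm (rl_kernel (of_real (Re \<mu> + a * real r)) t)))"
    by (intro summable_mult summable_ml assms)
  show "norm (X ^ r * norm (rl_kernel (\<mu> + of_real (a * real r)) t)) \<le>
    ?K * (X ^ r * norm (rl_kernel (of_real (Re \<mu> + a * real r)) t))" for r
    using mult_left_mono[OF norm_rl_kernel_shift_le[of \<mu> "a * real r" t], of "X ^ r"] assms
    by (simp add: mult_ac)
qed

lemma summable_ml_kernel:
  assumes "0 < Re \<mu>" "0 < a"
  shows "summable (\<lambda>r. norm (ml_coeff w c r * rl_kernel (\<mu> + of_real (a * real r)) t))"
proof (rule summable_comparison_test')
  show "summable (\<lambda>r. ((1 + norm c) * \<bar>w\<bar>) ^ r * norm (rl_kernel (\<mu> + of_real (a * real r)) t))"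
    by (intro summable_rl_kernel_shift assms) auto
  show "norm (norm (ml_coeff w c r * rl_kernel (\<mu> + of_real (a * real r)) t)) \<le>
    ((1 + norm c) * \<bar>w\<bar>) ^ r * norm (rl_kernel (\<mu> + of_real (a * real r)) t)" for r
    by (simp add: norm_mult mult_right_mono norm_ml_coeff_le)
qed

lemma ml_kernel_sums:
  assumes "0 < Re \<mu>" "0 < a"
  shows "(\<lambda>r. ml_coeff w c r * rl_kernel (\<mu> + of_real (a * real r)) t) sums ml_kernel a w c \<mu> t"
  unfolding ml_kernel_def by (intro summable_sums summable_norm_cancel[OF summable_ml_kernel] assms)

lemma ml_kernel_nonpos: "t \<le> 0 \<Longrightarrow> ml_kernel a w c \<mu> t = 0"
  by (simp add: ml_kernel_def rl_kernel_nonpos)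

lemma measurable_rl_kernel [measurable]: "rl_kernel s \<in> borel_measurable borel"
  unfolding rl_kernel_def[abs_def] by measurable

lemma measurable_ml_kernel [measurable]: "ml_kernel a w c \<mu> \<in> borel_measurable borel"
  unfolding ml_kernel_def[abs_def] by measurable

text \<open>Near 0 the kernel is no more singular than its leading term: after factoring out t^(Re
  \<mu> - 1) the remaining powers t^(a r) increase in t and can be frozen at T, where the series
  converges.\<close>

lemma ml_kernel_bound:
  assumes \<mu>: "0 < Re \<mu>" and a: "0 < a" and T: "0 < T"
  shows "\<exists>C\<ge>0. \<forall>t\<le>T. norm (ml_kernel a w c \<mu> t) \<le> C * norm (rl_kernel (of_real (Re \<mu>)) t)"
proof -
  define X where "X = (1 + norm c) * \<bar>w\<bar>"
  define K where "K = Gamma (Re \<mu>) / norm (Gamma \<mu>)"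
  define D where "D = (\<Sum>r. X ^ r * norm (rl_kernel (of_real (Re \<mu> + a * real r)) T))"
  define G where "G = norm (rl_kernel (of_real (Re \<mu>)) T)"
  have X: "0 \<le> X" and K: "0 \<le> K" using Gamma_real_pos[OF \<mu>] by (auto simp: X_def K_def)
  have gp: "norm (rl_kernel (of_real s) t) = t powr (s - 1) / Gamma s" if "0 < s" "0 < t" for s t
    using Gamma_real_pos[OF that(1)] that unfolding rl_kernel_def norm_divide Gamma_complex_of_real
    by (simp add: norm_pos_pow)
  have G: "0 < G" using T Gamma_real_pos[OF \<mu>] by (simp add: G_def gp \<mu>)
  have sm: "summable (\<lambda>r. X ^ r * norm (rl_kernel (of_real (Re \<mu> + a * real r)) T))"
    by (rule summable_ml[OF \<mu> a X])
  have D: "0 \<le> D" unfolding D_def using X by (intro suminf_nonneg sm) auto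
  have "norm (ml_kernel a w c \<mu> t) \<le> (K * D / G) * norm (rl_kernel (of_real (Re \<mu>)) t)" if t: "t \<le> T" for t
  proof (cases "0 < t")
    case True
    \<comment> \<open>This is (t / T)^(Re \<mu> - 1), the ratio of the leading terms at t and at
      T.\<close>
    define q where "q = norm (rl_kernel (of_real (Re \<mu>)) t) / G"
    have *: "norm (ml_coeff w c r * rl_kernel (\<mu> + of_real (a * real r)) t) \<le>
       (K * q) * (X ^ r * norm (rl_kernel (of_real (Re \<mu> + a * real r)) T))" for r
    proof -
      have s: "0 < Re \<mu> + a * real r" using \<mu> a by (simp add: add_pos_nonneg)
      have "norm (rl_kernel (of_real (Re \<mu> + a * real r)) t) \<le> q * norm (rl_kernel (of_real (Re \<mu> + a * real r)) T)"
      proof -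
        have "t powr (a * real r) \<le> T powr (a * real r)" using True t a by (intro powr_mono2) auto
        then have "t powr (Re \<mu> - 1) * t powr (a * real r) / Gamma (Re \<mu> + a * real r) \<le>
             t powr (Re \<mu> - 1) * T powr (a * real r) / Gamma (Re \<mu> + a * real r)"
          using Gamma_real_pos[OF s] by (intro divide_right_mono mult_left_mono) auto
        moreover have "q = t powr (Re \<mu> - 1) / T powr (Re \<mu> - 1)"
          using Gamma_real_pos[OF \<mu>] True T \<mu> by (simp add: q_def G_def gp less_imp_neq[symmetric])
        moreover have "x powr (Re \<mu> + a * real r - 1) = x powr (Re \<mu> - 1) * x powr (a * real r)" for x
          by (simp add: algebra_simps flip: powr_add)
        ultimately show ?thesis using True T unfolding gp[OF s True] gp[OF s T] by simp
      qed
      then have "norm (rl_kernel (\<mu> + of_real (a * real r)) t) \<le> K * (q * norm (rl_kernel (of_real (Re \<mu> + a * real r)) T))"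
        using K order_trans[OF norm_rl_kernel_shift_le[OF \<mu>, of "a * real r" t] mult_left_mono] a
        unfolding K_def by simp
      then have "norm (ml_coeff w c r) * norm (rl_kernel (\<mu> + of_real (a * real r)) t) \<le>
        X ^ r * (K * (q * norm (rl_kernel (of_real (Re \<mu> + a * real r)) T)))"
        using norm_ml_coeff_le[of w c r] X unfolding X_def by (intro mult_mono) auto
      then show ?thesis by (simp add: norm_mult mult_ac)
    qed
    have "norm (ml_kernel a w c \<mu> t) \<le> (\<Sum>r. norm (ml_coeff w c r * rl_kernel (\<mu> + of_real (a * real r)) t))"
      unfolding ml_kernel_def by (rule summable_norm[OF summable_ml_kernel[OF \<mu> a]])
    also have "\<dots> \<le> (\<Sum>r. (K * q) * (X ^ r * norm (rl_kernel (of_real (Re \<mu> + a * real r)) T)))"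
      by (intro suminf_le * summable_ml_kernel \<mu> a summable_mult sm)
    also have "\<dots> = (K * q) * D" unfolding D_def by (rule suminf_mult[OF sm])
    also have "\<dots> = (K * D / G) * norm (rl_kernel (of_real (Re \<mu>)) t)" by (simp add: q_def)
    finally show ?thesis .
  qed (simp add: ml_kernel_nonpos rl_kernel_nonpos)
  moreover have "0 \<le> K * D / G" using K D G by simp
  ultimately show ?thesis by blast
qed

lemma loc_integrable_ml_kernel:
  assumes \<mu>: "0 < Re \<mu>" and a: "0 < a"
  shows "loc_integrable (ml_kernel a w c \<mu>)"
proof (rule loc_integrable_bound[OF loc_integrable_rl_kernel measurable_ml_kernel])
  show "0 < Re (complex_of_real (Re \<mu>))" using \<mu> by simp
  fix T
  show "\<exists>C. \<forall>x. 0 \<le> x \<longrightarrow> x \<le> T \<longrightarrow> norm (ml_kernel a w c \<mu> x) \<le> C * norm (rl_kernel (of_real (Re \<mu>)) x)"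
  proof (cases "0 < T")
    case True
    then show ?thesis using ml_kernel_bound[OF \<mu> a True, of w c] by blast
  next
    case False
    then show ?thesis by (auto simp: ml_kernel_nonpos rl_kernel_nonpos)
  qed
qed

text \<open>For positive real exponents the kernels equal their own norms, so the semigroup law
  gives the integral of the absolute values exactly. These integrals dominate the termwise
  integration in \<open>lconv_ml_kernel\<close>.\<close>

lemma norm_rl_kernel_conv:
  assumes s: "0 < s" and r: "0 < r" and t: "0 < t"
  shows "has_bochner_integral lborel
    (\<lambda>y. indicator {0..t} y * (norm (rl_kernel (of_real s) (t - y)) * norm (rl_kernel (of_real r) y)))
    (norm (rl_kernel (of_real (s + r)) t))"
proof -
  let ?g = "\<lambda>y. indicator {0..t} y * (norm (rl_kernel (of_real s) (t - y)) * norm (rl_kernel (of_real r) y))"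
  have "complex_of_real (\<integral>y. ?g y \<partial>lborel) = (\<integral>y. of_real (?g y) \<partial>lborel)"
    by (rule integral_complex_of_real[symmetric])
  also have "\<dots> = lconv (rl_kernel (of_real s)) (rl_kernel (of_real r)) t"
    unfolding lconv_def set_lebesgue_integral_def
    by (intro Bochner_Integration.integral_cong refl)
       (simp add: rl_kernel_of_real[OF s, symmetric] rl_kernel_of_real[OF r, symmetric] scaleR_conv_of_real)
  also have "\<dots> = rl_kernel (of_real (s + r)) t"
    using lconv_rl_kernel[of "of_real s" "of_real r" t] s r by simp
  also have "\<dots> = of_real (norm (rl_kernel (of_real (s + r)) t))"
    using s r by (intro rl_kernel_of_real) simp
  finally have eq: "(\<integral>y. ?g y \<partial>lborel) = norm (rl_kernel (of_real (s + r)) t)"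
    unfolding of_real_eq_iff .
  \<comment> \<open>A non-integrable function has Bochner integral \<open>0\<close>, so integrability can be read off from the value.\<close>
  have "norm (rl_kernel (of_real (s + r)) t) \<noteq> 0"
    using s r t Gamma_nonzero_Re_pos[of "of_real (s + r)"] by (simp add: rl_kernel_def pos_pow_def)
  then have "integrable lborel ?g"
    using eq not_integrable_integral_eq by metis
  with eq show ?thesis by (simp add: has_bochner_integral_iff)
qed

text \<open>The product of the two series is grouped along the diagonals i + j = n. All convolutions
  on one diagonal give the same kernel, with exponent \<mu> + \<nu> + a n, so the coefficients
  collapse by \<open>ml_coeff_convolution\<close>. The rest is the domination needed to integrate
  the Cauchy product term by term.\<close>

lemma lconv_ml_kernel:
  assumes \<mu>: "0 < Re \<mu>" and \<nu>: "0 < Re \<nu>" and a: "0 < a"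
  shows "lconv (ml_kernel a w c \<mu>) (ml_kernel a w d \<nu>) t = ml_kernel a w (c + d) (\<mu> + \<nu>) t"
proof (cases "0 < t")
  case t: True
  define A where "A = (\<lambda>i x. ml_coeff w c i * rl_kernel (\<mu> + of_real (a * real i)) x)"
  define B where "B = (\<lambda>i x. ml_coeff w d i * rl_kernel (\<nu> + of_real (a * real i)) x)"
  define f where "f = (\<lambda>n y. indicator {0..t} y *\<^sub>R (\<Sum>i\<le>n. A i (t - y) * B (n - i) y))"
  \<comment> \<open>One base that dominates the bound of \<open>norm_ml_coeff_le\<close> for both c
    and d.\<close>
  define X where "X = (1 + norm c + norm d) * \<bar>w\<bar>"
  define K where "K = Gamma (Re \<mu>) / norm (Gamma \<mu>) * (Gamma (Re \<nu>) / norm (Gamma \<nu>))"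
  define g where "g = (\<lambda>i j y. indicator {0..t} y * (norm (rl_kernel (of_real (Re \<mu> + a * real i)) (t - y)) * norm (rl_kernel (of_real (Re \<nu> + a * real j)) y)))"
  have X: "0 \<le> X" by (simp add: X_def)
  have K: "0 \<le> K" using Gamma_real_pos[OF \<mu>] Gamma_real_pos[OF \<nu>] by (simp add: K_def)
  have g: "integrable lborel (g i j)"
    "(\<integral>y. g i j y \<partial>lborel) = norm (rl_kernel (of_real (Re (\<mu> + \<nu>) + a * real (i + j))) t)" for i j
    using norm_rl_kernel_conv[of "Re \<mu> + a * real i" "Re \<nu> + a * real j" t] \<mu> \<nu> a t
    by (simp_all add: has_bochner_integral_iff g_def add_pos_nonneg algebra_simps)
  have mA [measurable]: "A i \<in> borel_measurable borel" "B i \<in> borel_measurable borel" for i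
    unfolding A_def B_def by measurable
  have term_le: "norm (indicator {0..t} y *\<^sub>R (A i (t - y) * B j y)) \<le> (K * X ^ (i + j)) * g i j y" for i j y
  proof -
    have 1: "norm (A i (t - y)) \<le> X ^ i * (Gamma (Re \<mu>) / norm (Gamma \<mu>) * norm (rl_kernel (of_real (Re \<mu> + a * real i)) (t - y)))"
      unfolding A_def norm_mult
    proof (intro mult_mono norm_rl_kernel_shift_le)
      show "norm (ml_coeff w c i) \<le> X ^ i"
        by (rule order_trans[OF norm_ml_coeff_le power_mono]) (auto simp: X_def intro: mult_right_mono)
    qed (use \<mu> a X in auto)
    have 2: "norm (B j y) \<le> X ^ j * (Gamma (Re \<nu>) / norm (Gamma \<nu>) * norm (rl_kernel (of_real (Re \<nu> + a * real j)) y))"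
      unfolding B_def norm_mult
    proof (intro mult_mono norm_rl_kernel_shift_le)
      show "norm (ml_coeff w d j) \<le> X ^ j"
        by (rule order_trans[OF norm_ml_coeff_le power_mono]) (auto simp: X_def intro: mult_right_mono)
    qed (use \<nu> a X in auto)
    have "norm (A i (t - y) * B j y) \<le>
      X ^ i * (Gamma (Re \<mu>) / norm (Gamma \<mu>) * norm (rl_kernel (of_real (Re \<mu> + a * real i)) (t - y))) *
      (X ^ j * (Gamma (Re \<nu>) / norm (Gamma \<nu>) * norm (rl_kernel (of_real (Re \<nu> + a * real j)) y)))"
      unfolding norm_mult using order_trans[OF norm_ge_zero 1] by (intro mult_mono 1 2) auto
    then show ?thesis
      by (auto simp: indicator_def g_def K_def power_add mult_ac)
  qed
  have term_int: "integrable lborel (\<lambda>y. indicator {0..t} y *\<^sub>R (A i (t - y) * B j y))" for i j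
  proof (rule Bochner_Integration.integrable_bound)
    show "integrable lborel (\<lambda>y. (K * X ^ (i + j)) * g i j y)" using g(1) by auto
    show "AE y in lborel. norm (indicator {0..t} y *\<^sub>R (A i (t - y) * B j y)) \<le> norm ((K * X ^ (i + j)) * g i j y)"
      by (intro AE_I2 order_trans[OF term_le]) auto
  qed measurable
  have f_eq: "f n y = (\<Sum>i\<le>n. indicator {0..t} y *\<^sub>R (A i (t - y) * B (n - i) y))" for n y
    by (simp add: f_def scaleR_sum_right)
  have fint: "integrable lborel (f n)" for n
    unfolding f_eq[abs_def] by (intro Bochner_Integration.integrable_sum term_int)
  have sA: "summable (\<lambda>i. norm (A i x))" and sB: "summable (\<lambda>i. norm (B i x))" for x
    unfolding A_def B_def by (rule summable_ml_kernel[OF \<mu> a], rule summable_ml_kernel[OF \<nu> a])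
  have fsum: "(\<lambda>n. f n y) sums (indicator {0..t} y *\<^sub>R (ml_kernel a w c \<mu> (t - y) * ml_kernel a w d \<nu> y))" for y
    unfolding f_def ml_kernel_def A_def[symmetric] B_def[symmetric]
    using Cauchy_product_sums[OF sA[of "t - y"] sB[of y]] by (intro sums_scaleR_right) (simp add: A_def B_def)
  have "(\<lambda>n. \<integral>y. f n y \<partial>lborel) sums (\<integral>y. (\<Sum>n. f n y) \<partial>lborel)"
  proof (rule sums_integral[OF fint])
    have "summable (\<lambda>n. norm (f n y))" for y
    proof (rule summable_comparison_test')
      show "summable (\<lambda>n. \<Sum>i\<le>n. norm (A i (t - y)) * norm (B (n - i) y))"
        using sA sB by (intro summable_Cauchy_product) auto
      show "norm (norm (f n y)) \<le> (\<Sum>i\<le>n. norm (A i (t - y)) * norm (B (n - i) y))" for n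
        using norm_sum[of "\<lambda>i. A i (t - y) * B (n - i) y" "{..n}"]
        by (auto simp: f_def indicator_def norm_mult intro!: sum_nonneg)
    qed
    then show "AE y in lborel. summable (\<lambda>n. norm (f n y))" by simp
    show "summable (\<lambda>n. \<integral>y. norm (f n y) \<partial>lborel)"
    proof (rule summable_comparison_test')
      \<comment> \<open>Diagonal n contributes n + 1 equal bounds; n + 1 \<le> 2^n is absorbed into
        the base of the power.\<close>
      show "summable (\<lambda>n. K * ((2 * X) ^ n * norm (rl_kernel (of_real (Re (\<mu> + \<nu>) + a * real n)) t)))"
        using \<mu> \<nu> X by (intro summable_mult summable_ml a) auto
      fix n :: nat
      have "(\<integral>y. norm (f n y) \<partial>lborel) \<le> (\<integral>y. (\<Sum>i\<le>n. (K * X ^ n) * g i (n - i) y) \<partial>lborel)"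
      proof (rule integral_mono)
        show "integrable lborel (\<lambda>y. norm (f n y))" by (intro integrable_norm fint)
        show "integrable lborel (\<lambda>y. \<Sum>i\<le>n. (K * X ^ n) * g i (n - i) y)"
          using g(1) by (intro Bochner_Integration.integrable_sum integrable_mult_right) auto
        fix y
        show "norm (f n y) \<le> (\<Sum>i\<le>n. (K * X ^ n) * g i (n - i) y)"
          unfolding f_eq
          by (intro order_trans[OF norm_sum sum_mono]) (metis atMost_iff le_add_diff_inverse term_le)
      qed
      also have "\<dots> = (\<Sum>i\<le>n. (K * X ^ n) * (\<integral>y. g i (n - i) y \<partial>lborel))"
        using g(1) by (subst Bochner_Integration.integral_sum) auto
      also have "\<dots> = (\<Sum>i\<le>n. (K * X ^ n) * norm (rl_kernel (of_real (Re (\<mu> + \<nu>) + a * real n)) t))"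
        by (intro sum.cong refl) (simp add: g(2) flip: of_nat_add)
      also have "\<dots> = real (Suc n) * (K * (X ^ n * norm (rl_kernel (of_real (Re (\<mu> + \<nu>) + a * real n)) t)))"
        by simp
      also have "\<dots> \<le> 2 ^ n * (K * (X ^ n * norm (rl_kernel (of_real (Re (\<mu> + \<nu>) + a * real n)) t)))"
      proof (rule mult_right_mono)
        have "Suc n \<le> 2 ^ n" by (rule Suc_leI) (rule less_exp)
        then show "real (Suc n) \<le> 2 ^ n" by (metis of_nat_le_iff of_nat_numeral of_nat_power)
        show "0 \<le> K * (X ^ n * norm (rl_kernel (of_real (Re (\<mu> + \<nu>) + a * real n)) t))" using K X by simp
      qed
      finally show "norm (\<integral>y. norm (f n y) \<partial>lborel) \<le> K * ((2 * X) ^ n * norm (rl_kernel (of_real (Re (\<mu> + \<nu>) + a * real n)) t))"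
        by (simp add: power_mult_distrib mult_ac)
    qed
  qed
  also have "(\<lambda>n. \<integral>y. f n y \<partial>lborel) = (\<lambda>n. ml_coeff w (c + d) n * rl_kernel (\<mu> + \<nu> + of_real (a * real n)) t)"
  proof
    fix n
    have "(\<integral>y. f n y \<partial>lborel) = (\<Sum>i\<le>n. \<integral>y. indicator {0..t} y *\<^sub>R (A i (t - y) * B (n - i) y) \<partial>lborel)"
      unfolding f_eq by (rule Bochner_Integration.integral_sum) (rule term_int)
    also have "\<dots> = (\<Sum>i\<le>n. lconv (A i) (B (n - i)) t)"
      by (simp add: lconv_def set_lebesgue_integral_def)
    also have "\<dots> = (\<Sum>i\<le>n. ml_coeff w c i * ml_coeff w d (n - i) * rl_kernel (\<mu> + \<nu> + of_real (a * real n)) t)"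
    proof (intro sum.cong refl)
      fix i assume i: "i \<in> {..n}"
      have "lconv (A i) (B (n - i)) t = ml_coeff w c i * (ml_coeff w d (n - i) *
          lconv (rl_kernel (\<mu> + of_real (a * real i))) (rl_kernel (\<nu> + of_real (a * real (n - i)))) t)"
        unfolding A_def B_def by (simp only: lconv_scale_left lconv_scale_right)
      also have "lconv (rl_kernel (\<mu> + of_real (a * real i))) (rl_kernel (\<nu> + of_real (a * real (n - i)))) t =
          rl_kernel (\<mu> + of_real (a * real i) + (\<nu> + of_real (a * real (n - i)))) t"
        using \<mu> \<nu> a by (intro lconv_rl_kernel) (auto simp: add_pos_nonneg)
      also have "\<mu> + of_real (a * real i) + (\<nu> + of_real (a * real (n - i))) = \<mu> + \<nu> + of_real (a * real n)"
        using i by (simp add: of_nat_diff algebra_simps)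
      finally show "lconv (A i) (B (n - i)) t = ml_coeff w c i * ml_coeff w d (n - i) * rl_kernel (\<mu> + \<nu> + of_real (a * real n)) t"
        by (simp add: mult.assoc)
    qed
    also have "\<dots> = ml_coeff w (c + d) n * rl_kernel (\<mu> + \<nu> + of_real (a * real n)) t"
      by (simp add: ml_coeff_convolution flip: sum_distrib_right)
    finally show "(\<integral>y. f n y \<partial>lborel) = ml_coeff w (c + d) n * rl_kernel (\<mu> + \<nu> + of_real (a * real n)) t" .
  qed
  finally have "(\<integral>y. (\<Sum>n. f n y) \<partial>lborel) = ml_kernel a w (c + d) (\<mu> + \<nu>) t"
    unfolding ml_kernel_def by (rule sums_unique)
  moreover have "(\<Sum>n. f n y) = indicator {0..t} y *\<^sub>R (ml_kernel a w c \<mu> (t - y) * ml_kernel a w d \<nu> y)" for y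
    using sums_unique[OF fsum[of y]] by simp
  ultimately show ?thesis by (simp add: lconv_def set_lebesgue_integral_def)
qed (simp add: lconv_nonpos ml_kernel_nonpos)

lemma ml_kernel_0: "ml_kernel a w 0 \<mu> t = rl_kernel \<mu> t"
proof -
  have "ml_kernel a w 0 \<mu> t = (\<Sum>r\<in>{0}. ml_coeff w 0 r * rl_kernel (\<mu> + of_real (a * real r)) t)"
    unfolding ml_kernel_def by (rule suminf_finite) (auto simp: ml_coeff_def pochhammer_0_left)
  then show ?thesis by (simp add: ml_coeff_def)
qed

lemma lconv_ml_kernel_one:
  assumes "0 < Re \<mu>" "0 < a"
  shows "lconv (ml_kernel a w c \<mu>) (\<lambda>_. 1) t = ml_kernel a w c (\<mu> + 1) t"
proof -
  have "lconv (ml_kernel a w c \<mu>) (\<lambda>_. 1) t = lconv (ml_kernel a w c \<mu>) (ml_kernel a w 0 1) t"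
    by (rule lconv_cong) (auto simp: ml_kernel_0 rl_kernel_1)
  also have "\<dots> = ml_kernel a w c (\<mu> + 1) t" using lconv_ml_kernel[of \<mu> 1 a w c 0 t] assms by simp
  finally show ?thesis .
qed

section \<open>Majorants for nonnegative real parameters\<close>

lemma ml_coeff_nonneg:
  assumes "0 \<le> c" shows "ml_coeff \<bar>w\<bar> (of_real c) r = of_real (norm (ml_coeff w (of_real c) r))"
proof -
  have "pochhammer (complex_of_real c) r = of_real (pochhammer c r)" by (rule pochhammer_of_real)
  moreover have "0 \<le> pochhammer c r" using assms by (simp add: pochhammer_prod prod_nonneg)
  ultimately show ?thesis
    by (simp add: ml_coeff_def norm_mult norm_divide norm_power)
qed

text \<open>For real c \<ge> 0, replacing w by its modulus replaces every term of the series by its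
  norm. The majorant thus stays in the family of kernels and obeys the same convolution law.\<close>

lemma norm_ml_kernel_le:
  assumes "0 < \<mu>" "0 < a" "0 \<le> c"
  shows "norm (ml_kernel a w (of_real c) (of_real \<mu>) t) \<le> Re (ml_kernel a \<bar>w\<bar> (of_real c) (of_real \<mu>) t)"
    "(\<lambda>r. norm (ml_coeff w (of_real c) r) * norm (rl_kernel (of_real (\<mu> + a * real r)) t)) sums
       Re (ml_kernel a \<bar>w\<bar> (of_real c) (of_real \<mu>) t)"
proof -
  have p: "0 < \<mu> + a * real r" for r using assms by (simp add: add_pos_nonneg)
  have g: "rl_kernel (of_real \<mu> + of_real (a * real r)) t = of_real (norm (rl_kernel (of_real (\<mu> + a * real r)) t))" for r
    using rl_kernel_of_real[OF p, of r t] by simp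
  have "(\<lambda>r. ml_coeff \<bar>w\<bar> (of_real c) r * rl_kernel (of_real \<mu> + of_real (a * real r)) t) sums ml_kernel a \<bar>w\<bar> (of_real c) (of_real \<mu>) t"
    using assms by (intro ml_kernel_sums) auto
  then have "(\<lambda>r. Re (ml_coeff \<bar>w\<bar> (of_real c) r * rl_kernel (of_real \<mu> + of_real (a * real r)) t)) sums Re (ml_kernel a \<bar>w\<bar> (of_real c) (of_real \<mu>) t)"
    by (rule sums_Re)
  then show s: "(\<lambda>r. norm (ml_coeff w (of_real c) r) * norm (rl_kernel (of_real (\<mu> + a * real r)) t)) sums
       Re (ml_kernel a \<bar>w\<bar> (of_real c) (of_real \<mu>) t)"
    unfolding g ml_coeff_nonneg[OF assms(3)] by simp
  have "norm (ml_kernel a w (of_real c) (of_real \<mu>) t) \<le> (\<Sum>r. norm (ml_coeff w (of_real c) r * rl_kernel (of_real \<mu> + of_real (a * real r)) t))"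
    unfolding ml_kernel_def using assms by (intro summable_norm summable_ml_kernel) auto
  also have "\<dots> = Re (ml_kernel a \<bar>w\<bar> (of_real c) (of_real \<mu>) t)"
    using sums_unique[OF s] by (simp add: norm_mult)
  finally show "norm (ml_kernel a w (of_real c) (of_real \<mu>) t) \<le> Re (ml_kernel a \<bar>w\<bar> (of_real c) (of_real \<mu>) t)" .
qed

text \<open>The parameter c = \<gamma> j grows with j, and the coefficient bound of
  \<open>norm_ml_coeff_le\<close> grows with c inside an r-th power. Summing the coefficients
  exactly, as a binomial series, keeps the growth in j merely exponential.\<close>

lemma summable_ml_kernel_powers:
  fixes a b x t \<gamma> w :: real
  assumes a: "0 < a" and b: "0 < b" and \<gamma>: "0 \<le> \<gamma>" and x: "0 \<le> x"
  shows "summable (\<lambda>j. x ^ j * Re (ml_kernel a \<bar>w\<bar> (of_real (\<gamma> * real j)) (of_real (b * real j + 1)) t))"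
proof (cases "0 < t")
  case t: True
  \<comment> \<open>With \<open>1 / \<Gamma>(y) \<le> R e\<^sup>R R\<^bsup>-y\<^esup>\<close> the series over \<open>r\<close> becomes binomial and the series over \<open>j\<close> geometric.\<close>
  have "\<forall>\<^sub>F R in at_top. \<bar>w\<bar> * (t / R) powr a < 1 / 2 \<and> x * 2 powr \<gamma> * (t / R) powr b < 1 \<and> 1 \<le> R"
    by (intro eventually_conj eventually_scaled_powr_small a b t eventually_ge_at_top) auto
  then obtain R where R: "\<bar>w\<bar> * (t / R) powr a < 1 / 2" "x * 2 powr \<gamma> * (t / R) powr b < 1" "1 \<le> R"
    using eventually_happens' by force
  define q where "q = \<bar>w\<bar> * (t / R) powr a"
  have q: "0 \<le> q" "q < 1 / 2" using R by (auto simp: q_def)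
  define C where "C = (R * exp R / t) * (t / R)"
  have C: "0 \<le> C" using R t by (simp add: C_def)
  have le: "Re (ml_kernel a \<bar>w\<bar> (of_real (\<gamma> * real j)) (of_real (b * real j + 1)) t) \<le> C * (2 powr \<gamma> * (t / R) powr b) ^ j" for j
  proof -
    define c where "c = \<gamma> * real j"
    define \<mu> where "\<mu> = b * real j + 1"
    have c: "0 \<le> c" and \<mu>: "0 < \<mu>" using \<gamma> b by (simp_all add: c_def \<mu>_def add_nonneg_pos)
    have p: "0 < \<mu> + a * real r" for r using a \<mu> by (simp add: add_pos_nonneg)
    have n: "norm (rl_kernel (of_real (\<mu> + a * real r)) t) = t powr (\<mu> + a * real r - 1) / Gamma (\<mu> + a * real r)" for r
      using Gamma_real_pos[OF p[of r]] t
      unfolding rl_kernel_def pos_pow_of_real[OF t] Gamma_complex_of_real by (simp add: norm_divide)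
    have bin: "(\<lambda>r. (- c gchoose r) * (- q) ^ r) sums (1 + - q) powr (- c)"
      by (rule gen_binomial_real) (use q in auto)
    have "Re (ml_kernel a \<bar>w\<bar> (of_real c) (of_real \<mu>) t) \<le> ((R * exp R / t) * (t / R) powr \<mu>) * (1 + - q) powr (- c)"
    proof (rule sums_le)
      show "(\<lambda>r. norm (ml_coeff w (of_real c) r) * norm (rl_kernel (of_real (\<mu> + a * real r)) t)) sums
         Re (ml_kernel a \<bar>w\<bar> (of_real c) (of_real \<mu>) t)" by (rule norm_ml_kernel_le(2)[OF \<mu> a c])
      show "(\<lambda>r. ((R * exp R / t) * (t / R) powr \<mu>) * ((- c gchoose r) * (- q) ^ r)) sums
         (((R * exp R / t) * (t / R) powr \<mu>) * (1 + - q) powr (- c))" by (rule sums_mult[OF bin])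
      fix r
      have ch: "(- c gchoose r) * (- q) ^ r = pochhammer c r / fact r * q ^ r"
      proof -
        have "(- 1) ^ r * (- 1) ^ r = (1 :: real)" by (simp flip: power_mult_distrib)
        then have "(- 1) ^ r * pochhammer c r / fact r * ((- 1) ^ r * q ^ r) = pochhammer c r / fact r * q ^ r"
          by (simp add: mult_ac)
        then show ?thesis by (simp only: gbinomial_pochhammer power_minus[of q] minus_minus)
      qed
      have po: "norm (pochhammer (complex_of_real c) r) = pochhammer c r"
      proof -
        have "0 \<le> pochhammer c r" using c by (simp add: pochhammer_prod prod_nonneg)
        then show ?thesis by (simp add: pochhammer_of_real)
      qed
      have "norm (ml_coeff w (of_real c) r) * norm (rl_kernel (of_real (\<mu> + a * real r)) t) \<le>
         norm (ml_coeff w (of_real c) r) * ((R * exp R / t) * (t / R) powr (\<mu> + a * real r))"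
        unfolding n by (intro mult_left_mono powr_div_Gamma_le p R t) auto
      also have "\<dots> = ((R * exp R / t) * (t / R) powr \<mu>) * (pochhammer c r / fact r * q ^ r)"
        using t R by (simp add: ml_coeff_def norm_mult norm_divide norm_power po q_def power_mult_distrib
             powr_add powr_powr mult_ac flip: powr_realpow)
      finally show "norm (ml_coeff w (of_real c) r) * norm (rl_kernel (of_real (\<mu> + a * real r)) t) \<le>
        ((R * exp R / t) * (t / R) powr \<mu>) * ((- c gchoose r) * (- q) ^ r)" unfolding ch .
    qed
    \<comment> \<open>The requirement q < 1/2 on R is made for this bound: 2^c is (2^\<gamma>)^j,
      which explains the factor 2^\<gamma> in the second requirement.\<close>
    also have "\<dots> \<le> ((R * exp R / t) * (t / R) powr \<mu>) * 2 powr c"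
    proof (rule mult_left_mono)
      have "(1 + - q) powr (- c) \<le> (1 / 2) powr (- c)"
        using q c by (intro powr_mono2') auto
      also have "\<dots> = 2 powr c" by (simp add: powr_minus powr_divide)
      finally show "(1 + - q) powr (- c) \<le> 2 powr c" .
    qed (use t R in auto)
    also have "\<dots> = C * (2 powr \<gamma> * (t / R) powr b) ^ j"
      using t R by (simp add: C_def c_def \<mu>_def powr_add powr_powr power_mult_distrib flip: powr_realpow)
    finally show ?thesis by (simp add: c_def \<mu>_def)
  qed
  show ?thesis
  proof (rule summable_comparison_test')
    show "summable (\<lambda>j. C * (x * 2 powr \<gamma> * (t / R) powr b) ^ j)"
      using R x by (intro summable_mult summable_geometric) auto
    fix j
    have 0: "0 \<le> Re (ml_kernel a \<bar>w\<bar> (of_real (\<gamma> * real j)) (of_real (b * real j + 1)) t)"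
      using b a \<gamma> by (intro order_trans[OF norm_ge_zero norm_ml_kernel_le(1)[where w = w]]) (auto intro: add_nonneg_pos)
    have "x ^ j * Re (ml_kernel a \<bar>w\<bar> (of_real (\<gamma> * real j)) (of_real (b * real j + 1)) t) \<le> x ^ j * (C * (2 powr \<gamma> * (t / R) powr b) ^ j)"
      using x by (intro mult_left_mono le) auto
    with 0 show "norm (x ^ j * Re (ml_kernel a \<bar>w\<bar> (of_real (\<gamma> * real j)) (of_real (b * real j + 1)) t)) \<le> C * (x * 2 powr \<gamma> * (t / R) powr b) ^ j"
      using x by (simp add: power_mult_distrib mult_ac)
  qed
qed (simp add: ml_kernel_nonpos)

lemma ml_kernel_mittag_leffler3:
  assumes "0 < t" "0 < Re \<mu>" "0 < a"
  shows "of_real t powr (\<mu> - 1) * mittag_leffler3 (of_real a) \<mu> c (of_real (w * t powr a)) = ml_kernel a w c \<mu> t"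
proof -
  let ?f = "\<lambda>r. of_real (w * t powr a) ^ r * pochhammer c r / (fact r * Gamma (of_real a * of_nat r + \<mu>))"
  have eq: "ml_coeff w c r * rl_kernel (\<mu> + of_real (a * real r)) t = of_real t powr (\<mu> - 1) * ?f r" for r
  proof -
    have "of_real t powr (\<mu> + of_real (a * real r) - 1) = of_real t powr (\<mu> - 1) * of_real (t powr a) ^ r"
    proof -
      have "of_real t powr (\<mu> + of_real (a * real r) - 1) = of_real t powr ((\<mu> - 1) + of_real (a * real r))"
        by (simp add: algebra_simps)
      also have "\<dots> = of_real t powr (\<mu> - 1) * of_real (t powr (a * real r))"
        using assms by (subst powr_add) (simp add: powr_of_real[symmetric])
      also have "t powr (a * real r) = (t powr a) ^ r" using assms by (simp add: powr_powr flip: powr_realpow)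
      finally show ?thesis by simp
    qed
    then show ?thesis using assms
      by (simp add: ml_coeff_def rl_kernel_def pos_pow_eq_powr power_mult_distrib add.commute)
  qed
  have nz: "of_real t powr (\<mu> - 1) \<noteq> 0" using assms by simp
  have "summable (\<lambda>r. of_real t powr (\<mu> - 1) * ?f r)"
    unfolding eq[symmetric] by (rule sums_summable[OF ml_kernel_sums[OF assms(2,3)]])
  then have "summable ?f" using nz unfolding summable_cmult_iff by blast
  then show ?thesis unfolding ml_kernel_def mittag_leffler3_def eq by (rule suminf_mult[symmetric])
qed

subsection \<open>Absolutely convergent power series and the shift symbol\<close>

text \<open>Fubini for double series. The exchange is made for unordered sums \<open>infsum\<close>;
  absolute summability translates to and from ordered series at every stage.\<close>

lemma double_series_swap:
  fixes g :: "nat \<Rightarrow> nat \<Rightarrow> complex"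
  assumes 1: "\<And>n. summable (\<lambda>k. norm (g n k))" and 2: "summable (\<lambda>n. \<Sum>k. norm (g n k))"
  shows "summable (\<lambda>k. norm (\<Sum>n. g n k))" "(\<lambda>k. \<Sum>n. g n k) sums (\<Sum>n. \<Sum>k. g n k)"
    "summable (\<lambda>n. norm (g n k))"
proof -
  have inf_sum: "infsum f UNIV = suminf f" if "summable (\<lambda>n. norm (f n))" for f :: "nat \<Rightarrow> complex"
    using norm_summable_imp_has_sum[OF that summable_sums[OF summable_norm_cancel[OF that]]]
    by (rule infsumI)
  have inf_sum_norm: "infsum (\<lambda>k. norm (f k)) UNIV = (\<Sum>k. norm (f k))" if "summable (\<lambda>n. norm (f n))" for f :: "nat \<Rightarrow> complex"
    using sums_nonneg_imp_has_sum[OF summable_sums[OF that]] by (auto intro: infsumI)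
  have S: "(\<lambda>x. norm (case x of (n, k) \<Rightarrow> g n k)) summable_on (UNIV \<times> UNIV)"
    unfolding Infinite_Sum.abs_summable_on_Sigma_iff
  proof (intro conjI ballI)
    show "(\<lambda>k. norm (case (n, k) of (n, k) \<Rightarrow> g n k)) summable_on UNIV" for n
      using 1[of n] by (simp add: summable_on_UNIV_nonneg_real_iff)
    have "0 \<le> (\<Sum>k. norm (g n k))" for n using 1[of n] by (intro suminf_nonneg) auto
    then show "(\<lambda>n. norm (infsum (\<lambda>k. norm (case (n, k) of (n, k) \<Rightarrow> g n k)) UNIV)) summable_on UNIV"
      using 2 by (simp add: inf_sum_norm[OF 1] summable_on_UNIV_nonneg_real_iff)
  qed
  then have S': "(\<lambda>x. norm (case x of (k, n) \<Rightarrow> g n k)) summable_on (UNIV \<times> UNIV)"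
    by (subst (asm) summable_on_swap) (simp add: case_prod_unfold)
  have 3: "summable (\<lambda>n. norm (g n k))" for k
    using S' unfolding Infinite_Sum.abs_summable_on_Sigma_iff by (auto simp: summable_on_UNIV_nonneg_real_iff)
  show "summable (\<lambda>n. norm (g n k))" by (rule 3)
  have 4: "summable (\<lambda>k. \<Sum>n. norm (g n k))"
  proof -
    have "0 \<le> (\<Sum>n. norm (g n k))" for k using 3[of k] by (intro suminf_nonneg) auto
    then show ?thesis
      using S' unfolding Infinite_Sum.abs_summable_on_Sigma_iff
      by (auto simp: summable_on_UNIV_nonneg_real_iff inf_sum_norm[OF 3])
  qed
  show 5: "summable (\<lambda>k. norm (\<Sum>n. g n k))"
    by (rule summable_comparison_test'[OF 4]) (simp add: summable_norm[OF 3])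
  have 6: "summable (\<lambda>n. norm (\<Sum>k. g n k))"
    by (rule summable_comparison_test'[OF 2]) (simp add: summable_norm[OF 1])
  have "infsum (\<lambda>n. infsum (g n) UNIV) UNIV = infsum (\<lambda>k. infsum (\<lambda>n. g n k) UNIV) UNIV"
    by (rule infsum_swap_banach) (use abs_summable_summable[OF S] in simp)
  then have "(\<Sum>n. \<Sum>k. g n k) = (\<Sum>k. \<Sum>n. g n k)"
    by (simp add: inf_sum 1 3 5 6)
  then show "(\<lambda>k. \<Sum>n. g n k) sums (\<Sum>n. \<Sum>k. g n k)"
    using summable_sums[OF summable_norm_cancel[OF 5]] by simp
qed

section \<open>The Wiener algebra: power series with absolutely summable coefficients\<close>

definition wiener :: "complex fps \<Rightarrow> bool" where
  "wiener F \<longleftrightarrow> summable (\<lambda>k. norm (fps_nth F k))"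

definition wiener_norm :: "complex fps \<Rightarrow> real" where
  "wiener_norm F = (\<Sum>k. norm (fps_nth F k))"

lemma wiener_norm_nonneg: "wiener F \<Longrightarrow> 0 \<le> wiener_norm F"
  unfolding wiener_norm_def wiener_def by (rule suminf_nonneg) auto

lemma wiener_eval_summable:
  assumes "wiener F" "norm u \<le> 1"
  shows "summable (\<lambda>k. norm (fps_nth F k * u ^ k))"
proof (rule summable_comparison_test')
  show "summable (\<lambda>k. norm (fps_nth F k))" using assms by (simp add: wiener_def)
  show "norm (norm (fps_nth F k * u ^ k)) \<le> norm (fps_nth F k)" for k
    using assms(2) mult_left_mono[of "norm u ^ k" 1 "norm (fps_nth F k)"]
    by (simp add: norm_mult norm_power power_le_one)
qed

lemma wiener_mult:
  assumes "wiener F" "wiener G"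
  shows "wiener (F * G)" "wiener_norm (F * G) \<le> wiener_norm F * wiener_norm G"
    "norm u \<le> 1 \<Longrightarrow> (\<Sum>k. fps_nth (F * G) k * u ^ k) = (\<Sum>k. fps_nth F k * u ^ k) * (\<Sum>k. fps_nth G k * u ^ k)"
proof -
  let ?c = "\<lambda>k. \<Sum>i\<le>k. norm (fps_nth F i) * norm (fps_nth G (k - i))"
  have c: "?c sums (wiener_norm F * wiener_norm G)"
    unfolding wiener_norm_def using assms unfolding wiener_def
    by (intro Cauchy_product_sums) simp_all
  have le: "norm (fps_nth (F * G) k) \<le> ?c k" for k
    using norm_sum[of "\<lambda>i. fps_nth F i * fps_nth G (k - i)" "{..k}"]
    by (simp add: fps_mult_nth norm_mult atLeast0AtMost)
  show w: "wiener (F * G)"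
    unfolding wiener_def using le by (intro summable_comparison_test'[OF sums_summable[OF c]]) auto
  show "wiener_norm (F * G) \<le> wiener_norm F * wiener_norm G"
    unfolding sums_unique[OF c] unfolding wiener_norm_def
    by (intro suminf_le le sums_summable[OF c] w[unfolded wiener_def])
  assume u: "norm u \<le> 1"
  have "(\<lambda>k. \<Sum>i\<le>k. (fps_nth F i * u ^ i) * (fps_nth G (k - i) * u ^ (k - i))) sums
     ((\<Sum>k. fps_nth F k * u ^ k) * (\<Sum>k. fps_nth G k * u ^ k))"
    by (intro Cauchy_product_sums wiener_eval_summable assms u)
  also have "(\<lambda>k. \<Sum>i\<le>k. (fps_nth F i * u ^ i) * (fps_nth G (k - i) * u ^ (k - i))) =
    (\<lambda>k. fps_nth (F * G) k * u ^ k)"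
    by (auto simp: fun_eq_iff fps_mult_nth atLeast0AtMost sum_distrib_right power_diff_split intro!: sum.cong)
  finally show "(\<Sum>k. fps_nth (F * G) k * u ^ k) = (\<Sum>k. fps_nth F k * u ^ k) * (\<Sum>k. fps_nth G k * u ^ k)"
    by (rule sums_unique[symmetric])
qed

lemma wiener_one: "wiener 1" "wiener_norm 1 = 1" "(\<Sum>k. fps_nth 1 k * u ^ k) = (1 :: complex)"
proof -
  have 1: "(\<lambda>k. norm (fps_nth (1 :: complex fps) k)) sums (\<Sum>k\<in>{0}. norm (fps_nth (1 :: complex fps) k))"
    by (rule sums_finite) auto
  then show "wiener 1" "wiener_norm 1 = 1"
    by (simp_all add: wiener_def wiener_norm_def sums_iff)
  have "(\<Sum>k. fps_nth 1 k * u ^ k) = (\<Sum>k\<in>{0}. fps_nth 1 k * u ^ k)"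
    by (rule suminf_finite) auto
  then show "(\<Sum>k. fps_nth 1 k * u ^ k) = (1 :: complex)" by simp
qed

lemma wiener_power:
  assumes "wiener F"
  shows "wiener (F ^ n) \<and> wiener_norm (F ^ n) \<le> wiener_norm F ^ n \<and>
    (norm u \<le> 1 \<longrightarrow> (\<Sum>k. fps_nth (F ^ n) k * u ^ k) = (\<Sum>k. fps_nth F k * u ^ k) ^ n)"
proof (induction n)
  case (Suc n)
  then have w: "wiener (F ^ n)" by simp
  have "wiener_norm (F * F ^ n) \<le> wiener_norm F * wiener_norm F ^ n"
    using Suc by (intro order_trans[OF wiener_mult(2)[OF assms w] mult_left_mono] wiener_norm_nonneg assms) auto
  then show ?case using wiener_mult[OF assms w] Suc by auto
qed (simp add: wiener_one del: fps_one_nth)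

lemma norm_nth_le_wiener_norm: "wiener F \<Longrightarrow> norm (fps_nth F k) \<le> wiener_norm F"
  unfolding wiener_def wiener_norm_def
  using sum_le_suminf[of "\<lambda>k. norm (fps_nth F k)" "{k}"] by auto

text \<open>F may have a nonzero constant term, so infinitely many n contribute to each coefficient
  of H and the composition is not purely formal; the norm condition on b makes the double series
  absolutely convergent. It is applied twice: to the outer binomial series of the symbol, and to the
  solution series of the Cauchy problem.\<close>

lemma wiener_compose:
  assumes F: "wiener F" and b: "summable (\<lambda>n. norm (b n) * wiener_norm F ^ n)"
  defines "H \<equiv> Abs_fps (\<lambda>k. \<Sum>n. b n * fps_nth (F ^ n) k)"
  shows "wiener H"
    "norm u \<le> 1 \<Longrightarrow> (\<lambda>k. fps_nth H k * u ^ k) sums (\<Sum>n. b n * (\<Sum>k. fps_nth F k * u ^ k) ^ n)"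
    "norm u \<le> 1 \<Longrightarrow> summable (\<lambda>n. b n * (\<Sum>k. fps_nth F k * u ^ k) ^ n)"
    "summable (\<lambda>n. norm (b n * fps_nth (F ^ n) k))"
proof -
  have P: "wiener (F ^ n)" "wiener_norm (F ^ n) \<le> wiener_norm F ^ n"
     "norm u \<le> 1 \<Longrightarrow> (\<Sum>k. fps_nth (F ^ n) k * u ^ k) = (\<Sum>k. fps_nth F k * u ^ k) ^ n" for n u
    using wiener_power[OF F, of n u] by auto
  let ?g = "\<lambda>u n k. b n * fps_nth (F ^ n) k * u ^ k"
  have 1: "summable (\<lambda>k. norm (?g u n k))" if "norm u \<le> 1" for u n
    using summable_mult[OF wiener_eval_summable[OF P(1) that], of "norm (b n)"]
    by (simp add: norm_mult mult.assoc)
  have 2: "summable (\<lambda>n. \<Sum>k. norm (?g u n k))" if u: "norm u \<le> 1" for u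
  proof (rule summable_comparison_test'[OF b])
    fix n
    have "(\<Sum>k. norm (?g u n k)) \<le> (\<Sum>k. norm (b n) * norm (fps_nth (F ^ n) k))"
    proof (rule suminf_le[OF _ 1[OF u]])
      show "summable (\<lambda>k. norm (b n) * norm (fps_nth (F ^ n) k))"
        using P(1) by (intro summable_mult) (simp add: wiener_def)
      show "norm (?g u n k) \<le> norm (b n) * norm (fps_nth (F ^ n) k)" for k
        using mult_left_mono[of "norm u ^ k" 1 "norm (b n) * norm (fps_nth (F ^ n) k)"] u
        by (simp add: norm_mult norm_power power_le_one)
    qed
    also have "\<dots> = norm (b n) * wiener_norm (F ^ n)"
      using P(1) unfolding wiener_norm_def by (intro suminf_mult) (simp add: wiener_def)
    also have "\<dots> \<le> norm (b n) * wiener_norm F ^ n" by (intro mult_left_mono P) auto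
    finally show "norm (\<Sum>k. norm (?g u n k)) \<le> norm (b n) * wiener_norm F ^ n"
      using suminf_nonneg[OF 1[OF u]] by auto
  qed
  have 3: "summable (\<lambda>n. norm (b n * fps_nth (F ^ n) k))" for k
    using double_series_swap(3)[OF 1 2, of 1 k] by simp
  then show "summable (\<lambda>n. norm (b n * fps_nth (F ^ n) k))" .
  show "wiener H"
    using double_series_swap(1)[OF 1 2, of 1] by (simp add: wiener_def H_def)
  assume u: "norm u \<le> 1"
  have r: "(\<Sum>n. ?g u n k) = fps_nth H k * u ^ k" for k
    using suminf_mult2[OF summable_norm_cancel[OF 3[of k]], of "u ^ k"] by (simp add: H_def)
  have c: "(\<Sum>k. ?g u n k) = b n * (\<Sum>k. fps_nth F k * u ^ k) ^ n" for n
  proof -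
    have "(\<Sum>k. ?g u n k) = (\<Sum>k. b n * (fps_nth (F ^ n) k * u ^ k))" by (simp add: mult.assoc)
    also have "\<dots> = b n * (\<Sum>k. fps_nth (F ^ n) k * u ^ k)"
      by (intro suminf_mult summable_norm_cancel[OF wiener_eval_summable] P u)
    finally show ?thesis using P(3)[OF u] by simp
  qed
  show "(\<lambda>k. fps_nth H k * u ^ k) sums (\<Sum>n. b n * (\<Sum>k. fps_nth F k * u ^ k) ^ n)"
    using double_series_swap(2)[OF 1 2, of u] u unfolding r c by simp
  show "summable (\<lambda>n. b n * (\<Sum>k. fps_nth F k * u ^ k) ^ n)"
  proof (rule summable_comparison_test'[OF 2[OF u]])
    show "norm (b n * (\<Sum>k. fps_nth F k * u ^ k) ^ n) \<le> (\<Sum>k. norm (?g u n k))" for n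
      unfolding c[symmetric] by (rule summable_norm[OF 1[OF u]])
  qed
qed

section \<open>The binomial series of (1 - z)^\<nu> and the expansion of the shift symbol\<close>

definition one_minus_binomial :: "real \<Rightarrow> complex fps" where
  "one_minus_binomial \<nu> = Abs_fps (\<lambda>k. of_real (if k = 0 then 0 else - ((\<nu> gchoose k) * (- 1) ^ k)))"

text \<open>For k \<ge> 1 the coefficient is \<nu> (1 - \<nu>)_(k-1) / k!, nonnegative since 0 <
  \<nu> < 1. The partial sums have the closed form 1 - (1 - \<nu>)_j / j!, hence stay below
  1.\<close>

lemma wiener_one_minus_binomial:
  assumes "0 < \<nu>" "\<nu> < 1"
  shows "wiener (one_minus_binomial \<nu>)" "wiener_norm (one_minus_binomial \<nu>) \<le> 1"
proof -
  let ?a = "\<lambda>k. if k = 0 then 0 else - ((\<nu> gchoose k) * (- 1) ^ k)"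
  have sgn: "(x gchoose k) * (- 1) ^ k = pochhammer (- x) k / fact k" for x :: real and k
    by (simp add: gbinomial_pochhammer flip: power_mult_distrib)
  have a: "0 \<le> ?a k" for k
  proof (cases k)
    case (Suc j)
    have "0 \<le> pochhammer (1 - \<nu>) j" using assms by (simp add: pochhammer_prod prod_nonneg)
    moreover have "?a k = \<nu> * pochhammer (1 - \<nu>) j / fact (Suc j)"
      by (simp only: Suc sgn pochhammer_rec) simp
    ultimately show ?thesis using assms by simp
  qed simp
  have n: "norm (fps_nth (one_minus_binomial \<nu>) k) = ?a k" for k
    unfolding one_minus_binomial_def fps_nth_Abs_fps norm_of_real using a[of k] by simp
  have "(\<Sum>k<m. ?a k) \<le> 1" for m
  proof (cases m)
    case (Suc j)
    have "(\<Sum>k\<le>j. ?a k) + (\<Sum>k\<le>j. (\<nu> gchoose k) * (- 1) ^ k) = (\<Sum>k\<le>j. if k = 0 then 1 else 0)"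
      unfolding sum.distrib[symmetric] by (intro sum.cong) auto
    also have "\<dots> = 1" by (simp add: sum.delta)
    finally have "(\<Sum>k\<le>j. ?a k) + (- 1) ^ j * (\<nu> - 1 gchoose j) = 1"
      unfolding gbinomial_sum_lower_neg .
    moreover have "(- 1) ^ j * (\<nu> - 1 gchoose j) = pochhammer (1 - \<nu>) j / fact j"
      using sgn[of "\<nu> - 1" j] by (simp only: mult.commute minus_diff_eq)
    moreover have "0 \<le> pochhammer (1 - \<nu>) j / fact j"
      using assms by (simp add: pochhammer_prod prod_nonneg)
    ultimately have "(\<Sum>k\<le>j. ?a k) \<le> 1" by linarith
    then show ?thesis using Suc by (simp only: lessThan_Suc_atMost)
  qed simp
  then have "summable ?a" "(\<Sum>k. ?a k) \<le> 1"
    using a by (auto intro!: summableI_nonneg_bounded suminf_le_const)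
  then show "wiener (one_minus_binomial \<nu>)" "wiener_norm (one_minus_binomial \<nu>) \<le> 1"
    by (simp_all only: wiener_def wiener_norm_def n)
qed

lemma of_real_gbinomial: "of_real (x gchoose n) = (of_real x gchoose n :: complex)"
  by (simp add: gbinomial_prod_rev)

text \<open>The binomial theorem covers the open disc. Absolute summability makes the left side
  continuous on the closed disc, and so is the right side, even at u = 1 because \<nu> > 0; the
  identity extends to the boundary.\<close>

lemma eval_one_minus_binomial:
  assumes \<nu>: "0 < \<nu>" "\<nu> < 1" and u: "norm u \<le> 1"
  shows "(\<Sum>k. fps_nth (one_minus_binomial \<nu>) k * u ^ k) = 1 - (1 - u) powr of_real \<nu>"
proof -
  let ?S = "\<lambda>u. \<Sum>k. fps_nth (one_minus_binomial \<nu>) k * u ^ k"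
  have "uniform_limit (cball 0 1) (\<lambda>n z. \<Sum>k<n. fps_nth (one_minus_binomial \<nu>) k * z ^ k) ?S sequentially"
  proof (rule Weierstrass_m_test)
    show "summable (\<lambda>k. norm (fps_nth (one_minus_binomial \<nu>) k))"
      using wiener_one_minus_binomial(1)[OF \<nu>] by (simp add: wiener_def)
    show "norm (fps_nth (one_minus_binomial \<nu>) k * z ^ k) \<le> norm (fps_nth (one_minus_binomial \<nu>) k)"
      if "z \<in> cball 0 1" for k z
      using that mult_left_mono[of "norm z ^ k" 1 "norm (fps_nth (one_minus_binomial \<nu>) k)"]
      by (simp add: norm_mult norm_power power_le_one)
  qed
  then have cS: "continuous_on (cball 0 1) ?S"
    by (rule uniform_limit_theorem[rotated]) (auto intro!: always_eventually continuous_intros)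
  let ?h = "\<lambda>z. ?S z - (1 - (1 - z) powr of_real \<nu>)"
  have cl: "closure (ball 0 1) = cball (0 :: complex) 1" by (rule closure_ball) simp
  have zero: "?h z = 0" if "z \<in> ball 0 1" for z
  proof -
    have "(\<lambda>n. (of_real \<nu> gchoose n) * (- z) ^ n) sums (1 + - z) powr of_real \<nu>"
      using that by (intro gen_binomial_complex) simp
    then have "(\<lambda>n. (if n = 0 then 1 else 0) - (of_real \<nu> gchoose n) * (- z) ^ n) sums (1 - (1 + - z) powr of_real \<nu>)"
      using sums_single[of 0 "\<lambda>_. 1 :: complex"] by (intro sums_diff) auto
    also have "(\<lambda>n. (if n = 0 then 1 else 0) - (of_real \<nu> gchoose n) * (- z) ^ n) = (\<lambda>k. fps_nth (one_minus_binomial \<nu>) k * z ^ k)"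
      by (auto simp: fun_eq_iff one_minus_binomial_def of_real_gbinomial power_minus[of z])
    finally show ?thesis by (simp add: sums_iff)
  qed
  have cont: "continuous_on (closure (ball 0 1)) ?h"
  proof -
    \<comment> \<open>This keeps 1 - z off the branch cut of the principal power.\<close>
    have "Re (1 - z) \<ge> 0" if "norm z \<le> 1" for z using that complex_Re_le_cmod[of z] by simp
    then have "cball 0 1 \<subseteq> {z. 0 \<le> Re (1 - z) \<or> Im (1 - z) \<noteq> 0}" by auto
    then have "continuous_on (cball 0 1) (\<lambda>z. (1 - z) powr complex_of_real \<nu>)"
      by (rule continuous_on_powr_complex) (use \<nu> in \<open>auto intro!: continuous_on_diff continuous_on_const continuous_on_id\<close>)
    then show ?thesis unfolding cl by (intro continuous_on_diff cS continuous_on_const)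
  qed
  have "u \<in> closure (ball 0 1)" unfolding cl using u by simp
  from continuous_constant_on_closure[OF cont zero this] show ?thesis by simp
qed

text \<open>With A = 1 - (1 - z)^\<nu> one has \<eta> + L (1 - z)^\<nu> = (\<eta> + L) (1 - q A). As
  A has norm at most 1 and q < 1, the binomial series in q A converges in the Wiener
  algebra.\<close>

lemma shift_symbol_expansion:
  fixes \<nu> \<eta> l \<delta> :: real
  assumes \<nu>: "0 < \<nu>" "\<nu> < 1" and "0 < \<eta>" "0 < l"
  defines "F \<equiv> fps_expansion (shift_symbol \<eta> l \<nu> \<delta>) 0"
  shows "wiener F" "norm u \<le> 1 \<Longrightarrow> (\<lambda>k. fps_nth F k * u ^ k) sums shift_symbol \<eta> l \<nu> \<delta> u"
proof -
  define L where "L = l powr \<nu>"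
  \<comment> \<open>The fraction that remains after \<eta> + L is factored out; it is below 1
    because \<eta> > 0.\<close>
  define q where "q = L / (\<eta> + L)"
  define A where "A = one_minus_binomial \<nu>"
  define b where "b = (\<lambda>n. complex_of_real ((\<eta> + L) powr \<delta>) * ((of_real \<delta> gchoose n) * (- of_real q) ^ n))"
  define H where "H = Abs_fps (\<lambda>k. \<Sum>n. b n * fps_nth (A ^ n) k)"
  define G where "G = H - fps_const (of_real (\<eta> powr \<delta>))"
  have L: "0 < L" using assms by (simp add: L_def)
  have q: "0 < q" "q < 1" using L assms by (simp_all add: q_def)
  note wA = wiener_one_minus_binomial[OF \<nu>, folded A_def]
  have "summable (\<lambda>n. norm ((complex_of_real \<delta> gchoose n) * (- of_real q) ^ n))"
  proof (rule powser_insidea)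
    have "norm (complex_of_real ((1 + q) / 2)) < 1" using q unfolding norm_of_real by simp
    then show "summable (\<lambda>n. (of_real \<delta> gchoose n) * complex_of_real ((1 + q) / 2) ^ n)"
      by (rule sums_summable[OF gen_binomial_complex])
    show "norm (- complex_of_real q) < norm (complex_of_real ((1 + q) / 2))"
      using q unfolding norm_minus_cancel norm_of_real by simp
  qed
  then have sb: "summable (\<lambda>n. norm (b n))"
    unfolding b_def norm_mult[of "of_real _"] by (rule summable_mult)
  have "summable (\<lambda>n. norm (b n) * wiener_norm A ^ n)"
  proof (rule summable_comparison_test'[OF sb])
    show "norm (norm (b n) * wiener_norm A ^ n) \<le> norm (b n)" for n
      using wA wiener_norm_nonneg[OF wA(1)] mult_left_mono[of "wiener_norm A ^ n" 1 "norm (b n)"]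
      by (simp add: norm_mult power_le_one)
  qed
  note comp = wiener_compose[OF wA(1) this, folded H_def]
  have val: "(\<lambda>k. fps_nth G k * u ^ k) sums shift_symbol \<eta> l \<nu> \<delta> u" if u: "norm u \<le> 1" for u
  proof -
    define a where "a = (\<Sum>k. fps_nth A k * u ^ k)"
    have a: "a = 1 - (1 - u) powr of_real \<nu>" unfolding a_def A_def by (rule eval_one_minus_binomial[OF \<nu> u])
    have "norm a \<le> (\<Sum>k. norm (fps_nth A k * u ^ k))"
      unfolding a_def by (rule summable_norm[OF wiener_eval_summable[OF wA(1) u]])
    also have "\<dots> \<le> wiener_norm A"
      unfolding wiener_norm_def
    proof (intro suminf_le wiener_eval_summable wA u)
      show "norm (fps_nth A k * u ^ k) \<le> norm (fps_nth A k)" for k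
        using u mult_left_mono[of "norm u ^ k" 1 "norm (fps_nth A k)"]
        by (simp add: norm_mult norm_power power_le_one)
      show "summable (\<lambda>k. norm (fps_nth A k))" using wA(1) by (simp add: wiener_def)
    qed
    also have "\<dots> \<le> 1" by (rule wA(2))
    finally have "q * norm a \<le> q * 1" using q by (intro mult_left_mono) auto
    then have "q * norm a < 1" using q by linarith
    then have "norm (- of_real q * a) < 1" using q by (simp add: norm_mult)
    then have "(\<lambda>n. (of_real \<delta> gchoose n) * (- of_real q * a) ^ n) sums (1 + (- of_real q * a)) powr of_real \<delta>"
      by (rule gen_binomial_complex)
    from sums_mult[OF this, of "of_real ((\<eta> + L) powr \<delta>)"]
    have "(\<lambda>n. b n * a ^ n) sums (of_real ((\<eta> + L) powr \<delta>) * (1 + (- of_real q * a)) powr of_real \<delta>)"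
      by (simp only: b_def power_mult_distrib mult.assoc)
    also have "of_real ((\<eta> + L) powr \<delta>) = complex_of_real (\<eta> + L) powr of_real \<delta>"
      using L assms by (intro powr_of_real[symmetric]) simp
    \<comment> \<open>A positive real factor may be moved inside a principal power without crossing
      the cut.\<close>
    also have "\<dots> * (1 + (- of_real q * a)) powr of_real \<delta> = (of_real (\<eta> + L) * (1 + (- of_real q * a))) powr of_real \<delta>"
      using L assms by (intro powr_times_real_left[symmetric]) auto
    also have "of_real (\<eta> + L) * (1 + (- of_real q * a)) = of_real \<eta> + of_real L * (1 - u) powr of_real \<nu>"
    proof -
      have "complex_of_real (\<eta> + L) * of_real q = of_real L"
        using L assms unfolding of_real_mult[symmetric] by (simp add: q_def)
      then have "of_real (\<eta> + L) * (1 + (- of_real q * a)) = of_real (\<eta> + L) - of_real L * a"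
        by (simp add: algebra_simps del: of_real_add)
      then show ?thesis by (simp add: a algebra_simps)
    qed
    finally have "(\<Sum>n. b n * a ^ n) = shift_symbol \<eta> l \<nu> \<delta> u + of_real (\<eta> powr \<delta>)"
      by (simp add: sums_iff shift_symbol_def L_def)
    then have "(\<lambda>k. fps_nth H k * u ^ k) sums (shift_symbol \<eta> l \<nu> \<delta> u + of_real (\<eta> powr \<delta>))"
      using comp(2)[OF u] by (simp add: a_def)
    moreover have "(\<lambda>k. if k = 0 then complex_of_real (\<eta> powr \<delta>) else 0) sums of_real (\<eta> powr \<delta>)"
      using sums_single[of 0 "\<lambda>_. complex_of_real (\<eta> powr \<delta>)"] by simp
    ultimately have "(\<lambda>k. fps_nth H k * u ^ k - (if k = 0 then complex_of_real (\<eta> powr \<delta>) else 0)) sums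
       (shift_symbol \<eta> l \<nu> \<delta> u + of_real (\<eta> powr \<delta>) - of_real (\<eta> powr \<delta>))"
      by (rule sums_diff)
    moreover have "(\<lambda>k. fps_nth H k * u ^ k - (if k = 0 then complex_of_real (\<eta> powr \<delta>) else 0)) = (\<lambda>k. fps_nth G k * u ^ k)"
      by (auto simp: fun_eq_iff G_def)
    ultimately show ?thesis by simp
  qed
  \<comment> \<open>Convergence to the symbol near 0 identifies G, which was built by composition,
    with the Taylor series F.\<close>
  have "shift_symbol \<eta> l \<nu> \<delta> has_fps_expansion G"
  proof (rule has_fps_expansionI)
    have "\<forall>\<^sub>F u in nhds 0. norm (u :: complex) < 1"
      using eventually_nhds_in_open[of "ball 0 1" "0 :: complex"] by simp
    then show "\<forall>\<^sub>F u in nhds 0. (\<lambda>n. fps_nth G n * u ^ n) sums shift_symbol \<eta> l \<nu> \<delta> u"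
      by eventually_elim (auto intro: val)
  qed
  then have FG: "F = G" unfolding F_def by (rule fps_expansion_eqI)
  show "norm u \<le> 1 \<Longrightarrow> (\<lambda>k. fps_nth F k * u ^ k) sums shift_symbol \<eta> l \<nu> \<delta> u"
    unfolding FG by (rule val)
  have "summable (\<lambda>k. norm (fps_nth H k) + (if k = 0 then norm (complex_of_real (\<eta> powr \<delta>)) else 0))"
    using comp(1) sums_summable[OF sums_single[of 0 "\<lambda>_. norm (complex_of_real (\<eta> powr \<delta>))"]]
    by (intro summable_add) (simp_all add: wiener_def)
  then show "wiener F"
    unfolding FG wiener_def
    by (rule summable_comparison_test') (auto simp: G_def intro: norm_triangle_ineq4[THEN order_trans])
qed

subsection \<open>Inverting the Prabhakar derivative\<close>

lemma ml_kernel_0_fun: "ml_kernel a w 0 \<mu> = rl_kernel \<mu>"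
  by (simp add: fun_eq_iff ml_kernel_0)

text \<open>The case split avoids \<open>rl_kernel 0\<close>, which is \<open>0\<close> (division by \<open>Gamma 0 = 0\<close>) and not the unit of convolution.\<close>

definition iter_int :: "nat \<Rightarrow> (real \<Rightarrow> complex) \<Rightarrow> real \<Rightarrow> complex" where
  "iter_int m c = (if m = 0 then c else lconv (rl_kernel (of_nat m)) c)"

lemma continuous_on_iter_int:
  assumes "continuous_on {0..} c" shows "continuous_on {0..} (iter_int m c)"
proof (cases "m = 0")
  case False
  then show ?thesis
    by (simp add: iter_int_def) (intro continuous_on_lconv loc_integrable_rl_kernel assms, simp)
qed (simp add: iter_int_def assms)

lemma iter_int_Suc:
  assumes c: "continuous_on {0..} c"
  shows "iter_int (Suc m) c t = lconv (\<lambda>_. 1) (iter_int m c) t"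
proof -
  have "lconv (\<lambda>_. 1) (iter_int m c) t = lconv (rl_kernel 1) (iter_int m c) t"
    by (rule lconv_cong) (simp_all add: rl_kernel_1)
  also have "\<dots> = iter_int (Suc m) c t"
  proof (cases "m = 0")
    case False
    have "lconv (rl_kernel 1) (lconv (rl_kernel (of_nat m)) c) t = lconv (lconv (rl_kernel 1) (rl_kernel (of_nat m))) c t"
      using False by (intro lconv_assoc loc_integrable_rl_kernel c) auto
    also have "lconv (rl_kernel 1) (rl_kernel (of_nat m)) = rl_kernel (of_nat (Suc m))"
      using False by (simp add: fun_eq_iff lconv_rl_kernel)
    finally show ?thesis using False by (simp add: iter_int_def)
  qed (simp add: iter_int_def)
  finally show ?thesis by simp
qed

lemma iter_int_has_derivative:
  assumes c: "continuous_on {0..} c" and t: "0 < t"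
  shows "(iter_int (Suc m) c has_vector_derivative iter_int m c t) (at t)"
proof -
  have "iter_int (Suc m) c = lconv (\<lambda>_. 1) (iter_int m c)"
    by (simp add: fun_eq_iff iter_int_Suc[OF c])
  then show ?thesis using lconv_one_has_derivative[OF continuous_on_iter_int[OF c] t] by simp
qed

text \<open>Injectivity of m-fold integration on continuous functions: each derivative taken on t >
  0 removes one integration.\<close>

lemma iter_int_eq_0D:
  assumes d: "continuous_on {0..} d" and 0: "\<And>t. 0 < t \<Longrightarrow> iter_int m d t = 0" and t: "0 < t"
  shows "d t = 0"
  using 0 t
proof (induction m arbitrary: t)
  case (Suc m)
  show ?case
  proof (rule Suc.IH)
    fix s :: real assume s: "0 < s"
    have "((\<lambda>_. 0) has_vector_derivative iter_int m d s) (at s)"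
      by (rule has_vector_derivative_transform_within_open[OF iter_int_has_derivative[OF d s], of "{0<..}"])
         (use s Suc.prems in auto)
    then show "iter_int m d s = 0"
      using vector_derivative_unique_at[OF has_vector_derivative_const] by metis
  qed (rule Suc.prems(2))
qed (simp add: iter_int_def)

lemma iter_deriv_Suc: "iter_deriv (Suc i) R = iter_deriv i (\<lambda>s. vector_derivative R (at s))"
  by (simp add: iter_deriv_def funpow_Suc_right del: funpow.simps)

text \<open>Induction peels off the innermost derivative. Since everything is known only for t > 0,
  each integration leaves an undetermined constant, and the constants accumulate to a polynomial of
  degree below m.\<close>

lemma iter_deriv_taylor:
  assumes "\<And>i t. i < m \<Longrightarrow> 0 < t \<Longrightarrow> iter_deriv i R differentiable (at t)"
    and "\<And>t. 0 < t \<Longrightarrow> iter_deriv m R t = c t" and c: "continuous_on {0..} c"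
  shows "\<exists>p. \<forall>t>0. R t = iter_int m c t + (\<Sum>i<m. p i * of_real t ^ i)"
  using assms(1,2)
proof (induction m arbitrary: R)
  case 0
  then show ?case by (simp add: iter_deriv_def iter_int_def)
next
  case (Suc m)
  let ?R' = "\<lambda>s. vector_derivative R (at s)"
  have "\<exists>p. \<forall>t>0. ?R' t = iter_int m c t + (\<Sum>i<m. p i * of_real t ^ i)"
  proof (rule Suc.IH)
    show "iter_deriv i ?R' differentiable (at t)" if "i < m" "0 < t" for i t
      using Suc.prems(1)[of "Suc i" t] that by (simp add: iter_deriv_Suc)
    show "iter_deriv m ?R' t = c t" if "0 < t" for t
      using Suc.prems(2)[OF that] by (simp add: iter_deriv_Suc)
  qed
  then obtain p where p: "\<And>t. 0 < t \<Longrightarrow> ?R' t = iter_int m c t + (\<Sum>i<m. p i * of_real t ^ i)" by blast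
  let ?q = "\<lambda>t. \<Sum>i<m. p i / of_nat (Suc i) * complex_of_real t ^ Suc i"
  have "(\<lambda>t. R t - iter_int (Suc m) c t - ?q t) constant_on {0<..}"
  proof -
    have d: "((\<lambda>t. R t - iter_int (Suc m) c t - ?q t) has_vector_derivative 0) (at t within {0<..})" if t: "t \<in> {0<..}" for t
    proof -
      have "iter_deriv 0 R differentiable (at t)" using Suc.prems(1)[of 0 t] t by simp
      then have 1: "(R has_vector_derivative ?R' t) (at t)"
        by (simp add: iter_deriv_def vector_derivative_works)
      have "((\<lambda>z. \<Sum>i<m. p i / of_nat (Suc i) * z ^ Suc i) has_field_derivative (\<Sum>i<m. p i * of_real t ^ i)) (at (of_real t))"
        by (rule DERIV_sum) (auto intro!: derivative_eq_intros simp del: power_Suc of_nat_Suc simp: field_simps)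
      then have 2: "(?q has_vector_derivative (\<Sum>i<m. p i * of_real t ^ i)) (at t)"
        by (rule has_vector_derivative_real_field)
      have 3: "(iter_int (Suc m) c has_vector_derivative iter_int m c t) (at t)"
        by (rule iter_int_has_derivative[OF c]) (use t in simp)
      have "((\<lambda>t. R t - iter_int (Suc m) c t - ?q t) has_vector_derivative ?R' t - iter_int m c t - (\<Sum>i<m. p i * of_real t ^ i)) (at t)"
        by (intro has_vector_derivative_diff 1 2 3)
      then show ?thesis using p[of t] t by (auto intro: has_vector_derivative_at_within)
    qed
    show ?thesis
      unfolding constant_on_def using has_vector_derivative_zero_constant[OF _ d] by (metis convex_real_interval(3))
  qed
  then obtain k where k: "\<And>t. 0 < t \<Longrightarrow> R t - iter_int (Suc m) c t - ?q t = k"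
    unfolding constant_on_def by auto
  show ?case
  \<comment> \<open>The old polynomial is integrated term by term and k is the new constant of
    integration.\<close>
  proof (intro exI[of _ "\<lambda>i. case i of 0 \<Rightarrow> k | Suc j \<Rightarrow> p j / of_nat (Suc j)"] allI impI)
    fix t :: real assume "0 < t"
    have "(\<Sum>i<Suc m. (case i of 0 \<Rightarrow> k | Suc j \<Rightarrow> p j / of_nat (Suc j)) * complex_of_real t ^ i) = k + ?q t"
      by (subst sum.lessThan_Suc_shift) simp
    then show "R t = iter_int (Suc m) c t + (\<Sum>i<Suc m. (case i of 0 \<Rightarrow> k | Suc j \<Rightarrow> p j / of_nat (Suc j)) * complex_of_real t ^ i)"
      using k[OF \<open>0 < t\<close>] by (simp add: algebra_simps)
  qed
qed

text \<open>A polynomial of degree below m that is o(t^(m-1)) at 0 is zero: its limit at 0 kills the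
  constant coefficient, and dividing by t lowers both the degree and the order of smallness by
  one.\<close>

lemma poly_small_imp_0:
  fixes p :: "nat \<Rightarrow> complex"
  assumes "((\<lambda>t. (\<Sum>i<m. p i * of_real t ^ i) / of_real t ^ (m - 1)) \<longlongrightarrow> 0) (at_right 0)" "i < m"
  shows "p i = 0"
  using assms
proof (induction m arbitrary: p i)
  case (Suc m)
  let ?P = "\<lambda>t::real. \<Sum>i<Suc m. p i * of_real t ^ i"
  have "((\<lambda>t. (?P t / of_real t ^ m) * of_real t ^ m) \<longlongrightarrow> 0 * of_real 0 ^ m) (at_right 0)"
    using Suc.prems(1) by (intro tendsto_intros) auto
  then have "(?P \<longlongrightarrow> 0) (at_right 0)"
    by (simp, subst (asm) tendsto_cong[where g = ?P]) (auto simp: eventually_at_filter)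
  moreover have "(?P \<longlongrightarrow> ?P 0) (at_right 0)" by (intro tendsto_intros)
  ultimately have "?P 0 = 0" using tendsto_unique[OF trivial_limit_at_right_real] by blast
  moreover have "?P 0 = p 0" by (subst sum.lessThan_Suc_shift) simp
  ultimately have p0: "p 0 = 0" by simp
  show ?case
  proof (cases i)
    case (Suc j)
    with Suc.prems obtain n where n: "m = Suc n" by (cases m) auto
    have "((\<lambda>t. (\<Sum>i<m. p (Suc i) * of_real t ^ i) / of_real t ^ (m - 1)) \<longlongrightarrow> 0) (at_right 0)"
    proof (rule tendsto_cong[THEN iffD1, OF _ Suc.prems(1)])
      have "?P t / of_real t ^ (Suc m - 1) = (\<Sum>i<m. p (Suc i) * of_real t ^ i) / of_real t ^ (m - 1)" if "0 < t" for t
      proof -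
        have "?P t = of_real t * (\<Sum>i<m. p (Suc i) * of_real t ^ i)"
          by (subst sum.lessThan_Suc_shift) (simp add: p0 sum_distrib_left mult_ac)
        then show ?thesis using that by (simp add: n)
      qed
      then show "\<forall>\<^sub>F t in at_right 0. ?P t / of_real t ^ (Suc m - 1) = (\<Sum>i<m. p (Suc i) * of_real t ^ i) / of_real t ^ (m - 1)"
        by (auto simp: eventually_at_filter)
    qed
    then show ?thesis using Suc.IH[of "\<lambda>i. p (Suc i)" j] Suc.prems(2) Suc by simp
  qed (use p0 in simp)
qed simp

text \<open>The kernel is dominated near 0 by a multiple of t^(\<mu>-1), whose integral is of order
  t^\<mu>. The constant is chosen before f, S and t, so that S may later shrink together with
  t.\<close>

lemma lconv_ml_kernel_small:
  assumes \<mu>: "0 < \<mu>" and a: "0 < a"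
  obtains D where "0 < D" "\<And>f S t. continuous_on {0..} f \<Longrightarrow> 0 < t \<Longrightarrow> t \<le> 1 \<Longrightarrow>
     (\<And>x. 0 \<le> x \<Longrightarrow> x \<le> t \<Longrightarrow> norm (f x) \<le> S) \<Longrightarrow> norm (lconv (ml_kernel a w c (of_real \<mu>)) f t) \<le> D * S * t powr \<mu>"
proof -
  obtain C where C: "0 \<le> C" "\<And>t. t \<le> 1 \<Longrightarrow> norm (ml_kernel a w c (of_real \<mu>) t) \<le> C * norm (rl_kernel (of_real \<mu>) t)"
    using ml_kernel_bound[of "of_real \<mu>" a 1 w c] \<mu> a by auto
  \<comment> \<open>C may be 0; adding 1 makes the constant positive, so that one can divide by
    it.\<close>
  let ?D = "C / Gamma (\<mu> + 1) + 1"
  have D: "0 < ?D" using C(1) Gamma_real_pos[of "\<mu> + 1"] \<mu> by (intro add_nonneg_pos) auto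
  show thesis
  proof (rule that[OF D])
    fix f :: "real \<Rightarrow> complex" and S t :: real assume f: "continuous_on {0..} f" and t: "0 < t" "t \<le> 1"
      and S: "\<And>x. 0 \<le> x \<Longrightarrow> x \<le> t \<Longrightarrow> norm (f x) \<le> S"
    have S0: "0 \<le> S" using S[of 0] t norm_ge_zero[of "f 0"] by linarith
    have "norm (lconv (ml_kernel a w c (of_real \<mu>)) f t) \<le> S * Re (lconv (\<lambda>x. of_real C * rl_kernel (of_real \<mu>) x) (\<lambda>_. 1) t)"
    proof (rule norm_lconv_le[OF _ f S])
      show "loc_integrable (ml_kernel a w c (of_real \<mu>))" using \<mu> a by (intro loc_integrable_ml_kernel) auto
      show "loc_integrable (\<lambda>x. of_real C * rl_kernel (of_real \<mu>) x)"
        by (rule loc_integrable_bound[OF loc_integrable_rl_kernel[of "of_real \<mu>"]])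
           (use \<mu> C(1) in \<open>auto simp: norm_mult intro!: exI[of _ C] mult_right_mono\<close>)
      show "norm (ml_kernel a w c (of_real \<mu>) x) \<le> Re (of_real C * rl_kernel (of_real \<mu>) x)" if "0 \<le> x" "x \<le> t" for x
        using C(2)[of x] that t by (subst rl_kernel_of_real[OF \<mu>]) simp
    qed
    also have "lconv (\<lambda>x. of_real C * rl_kernel (of_real \<mu>) x) (\<lambda>_. 1) t = of_real C * rl_kernel (of_real \<mu> + 1) t"
      using lconv_ml_kernel_one[of "of_real \<mu>" a w 0 t] \<mu> a by (simp add: lconv_scale_left ml_kernel_0_fun)
    also have "rl_kernel (of_real \<mu> + 1) t = of_real (t powr \<mu> / Gamma (\<mu> + 1))"
      using t by (simp add: rl_kernel_def pos_pow_of_real[of t "\<mu> + 1", simplified] Gamma_complex_of_real[of "\<mu> + 1", simplified])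
    also have "S * Re (of_real C * of_real (t powr \<mu> / Gamma (\<mu> + 1))) = C / Gamma (\<mu> + 1) * S * t powr \<mu>"
      by simp
    also have "\<dots> \<le> ?D * S * t powr \<mu>" using S0 by (intro mult_right_mono) auto
    finally show "norm (lconv (ml_kernel a w c (of_real \<mu>)) f t) \<le> ?D * S * t powr \<mu>" .
  qed
qed

lemma continuous_on_bounded_Icc:
  fixes f :: "real \<Rightarrow> complex"
  assumes "continuous_on {0..} f"
  obtains C where "0 < C" "\<And>x. 0 \<le> x \<Longrightarrow> x \<le> t \<Longrightarrow> norm (f x) \<le> C"
proof -
  obtain C where "0 < C" "\<And>x. norm (trunc t f x) \<le> C" using trunc_bounded[OF assms] by blast
  then have "norm (f x) \<le> C" if "0 \<le> x" "x \<le> t" for x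
    using that by (metis atLeastAtMost_iff indicator_simps(1) scaleR_one trunc_def)
  with \<open>0 < C\<close> that show thesis by blast
qed

section \<open>The Prabhakar derivative as a derivative of a convolution, and its inversion\<close>

lemma kernel_integral_eq_lconv:
  assumes "0 < Re \<theta>" "0 < \<alpha>"
  shows "prabhakar_kernel_integral \<theta> \<gamma> \<alpha> w f t = lconv (ml_kernel \<alpha> w (- of_real \<gamma>) \<theta>) f t"
  unfolding prabhakar_kernel_integral_def lconv_def set_lebesgue_integral_def
proof (intro Bochner_Integration.integral_cong refl)
  fix y
  have "complex_of_real (t - y) powr (\<theta> - 1) * mittag_leffler3 (of_real \<alpha>) \<theta> (- of_real \<gamma>) (of_real (w * (t - y) powr \<alpha>))
     = ml_kernel \<alpha> w (- of_real \<gamma>) \<theta> (t - y)" if "y \<le> t"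
  \<comment> \<open>At y = t both sides are 0, because \<open>0 powr z = 0\<close> and the kernel
    vanishes at 0.\<close>
  proof (cases "y = t")
    case False
    then show ?thesis using that assms by (intro ml_kernel_mittag_leffler3) auto
  qed (simp add: ml_kernel_nonpos)
  then show "indicator {0..t} y *\<^sub>R (complex_of_real (t - y) powr (\<theta> - 1) *
       mittag_leffler3 (of_real \<alpha>) \<theta> (- of_real \<gamma>) (of_real (w * (t - y) powr \<alpha>)) * f y) =
     indicator {0..t} y *\<^sub>R (ml_kernel \<alpha> w (- of_real \<gamma>) \<theta> (t - y) * f y)"
    by (auto simp: indicator_def)
qed

lemma RL_integral_eq_lconv: "RL_integral a g t = lconv (pos_pow (of_nat (RL_index a) - a)) g t"
  unfolding RL_integral_def lconv_def set_lebesgue_integral_def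
proof (intro Bochner_Integration.integral_cong refl)
  fix y
  have "g y / complex_of_real (t - y) powr (a - of_nat (RL_index a) + 1) = pos_pow (of_nat (RL_index a) - a) (t - y) * g y" if "y \<le> t"
  proof (cases "y = t")
    case False
    then show ?thesis
      using that powr_minus[of "complex_of_real (t - y)" "a - of_nat (RL_index a) + 1"]
      by (simp add: pos_pow_eq_powr divide_inverse algebra_simps)
  qed (simp add: pos_pow_nonpos)
  then show "indicator {0..t} y *\<^sub>R (g y / complex_of_real (t - y) powr (a - of_nat (RL_index a) + 1)) =
     indicator {0..t} y *\<^sub>R (pos_pow (of_nat (RL_index a) - a) (t - y) * g y)"
    by (auto simp: indicator_def)
qed

text \<open>Let J be m-fold integration. Integrating the equation back gives g = J r, where g is f
  convolved with the kernel of parameters -\<gamma> and m - \<beta>. Convolution with the kernel of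
  parameters \<gamma> and \<beta> turns g into J f and J r into J of the claimed right side, and J
  is injective.\<close>

lemma prabhakar_inversion:
  fixes f r :: "real \<Rightarrow> complex" and \<theta> :: complex
  assumes f: "continuous_on {0..} f" "f 0 = 0" and r: "continuous_on {0..} r"
    and \<alpha>: "0 < \<alpha>" and \<beta>: "0 < \<beta>" "\<beta> \<le> 1" and \<theta>: "0 < Re \<theta>"
    and diff: "prabhakar_differentiable \<theta> \<gamma> \<alpha> \<beta> w f"
    and eq: "\<And>t. 0 < t \<Longrightarrow> prabhakar_derivative \<theta> \<gamma> \<alpha> \<beta> w f t = r t"
    and t: "0 \<le> t"
  shows "f t = lconv (ml_kernel \<alpha> w (of_real \<gamma>) (of_real \<beta>)) r t"
proof -
  define a where "a = of_real \<beta> + \<theta>"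
  define m where "m = RL_index a"
  \<comment> \<open>The exponent of the Riemann-Liouville kernel. Since m exceeds Re a, both Re
    \<rho> and \<mu> = \<rho> + \<theta> are positive, and \<mu> no longer involves
    \<theta>.\<close>
  define \<rho> where "\<rho> = of_nat m - a"
  define \<mu> where "\<mu> = real m - \<beta>"
  define g where "g = lconv (ml_kernel \<alpha> w (- of_real \<gamma>) (of_real \<mu>)) f"
  have Rea: "0 < Re a" using \<beta> \<theta> by (simp add: a_def)
  then have "int m = \<lfloor>Re a\<rfloor> + 1" by (simp add: m_def RL_index_def)
  then have m: "Re a < real m" by linarith
  have \<mu>: "0 < \<mu>" using m \<theta> by (simp add: \<mu>_def a_def)
  have m1: "1 \<le> m" using m Rea by linarith
  have \<rho>: "0 < Re \<rho>" using m by (simp add: \<rho>_def)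
  have G: "Gamma \<rho> \<noteq> 0" by (rule Gamma_nonzero_Re_pos[OF \<rho>])
  define R where "R = RL_integral a (prabhakar_kernel_integral \<theta> \<gamma> \<alpha> w f)"
  have R: "R s = Gamma \<rho> * g s" for s
  proof -
    have "R s = lconv (pos_pow \<rho>) (lconv (ml_kernel \<alpha> w (- of_real \<gamma>) \<theta>) f) s"
      unfolding R_def RL_integral_eq_lconv \<rho>_def m_def
      using kernel_integral_eq_lconv[OF \<theta> \<alpha>, of \<gamma> w f] by (simp add: fun_eq_iff[symmetric] cong: lconv_cong)
    also have "\<dots> = lconv (lconv (pos_pow \<rho>) (ml_kernel \<alpha> w (- of_real \<gamma>) \<theta>)) f s"
      by (intro lconv_assoc loc_integrable_pos_pow loc_integrable_ml_kernel \<rho> \<theta> \<alpha> f)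
    also have "lconv (pos_pow \<rho>) (ml_kernel \<alpha> w (- of_real \<gamma>) \<theta>) = (\<lambda>x. Gamma \<rho> * ml_kernel \<alpha> w (- of_real \<gamma>) (of_real \<mu>) x)"
    proof
      fix x
      have "lconv (pos_pow \<rho>) (ml_kernel \<alpha> w (- of_real \<gamma>) \<theta>) x = lconv (\<lambda>x. Gamma \<rho> * ml_kernel \<alpha> w 0 \<rho> x) (ml_kernel \<alpha> w (- of_real \<gamma>) \<theta>) x"
        using G by (simp add: ml_kernel_0 rl_kernel_def)
      also have "\<dots> = Gamma \<rho> * ml_kernel \<alpha> w (- of_real \<gamma>) (\<rho> + \<theta>) x"
        by (simp add: lconv_scale_left lconv_ml_kernel \<rho> \<theta> \<alpha>)
      also have "\<rho> + \<theta> = of_real \<mu>" by (simp add: \<rho>_def \<mu>_def a_def)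
      finally show "lconv (pos_pow \<rho>) (ml_kernel \<alpha> w (- of_real \<gamma>) \<theta>) x = Gamma \<rho> * ml_kernel \<alpha> w (- of_real \<gamma>) (of_real \<mu>) x" .
    qed
    finally show ?thesis by (simp add: lconv_scale_left g_def)
  qed
  have cr: "continuous_on {0..} (\<lambda>s. Gamma \<rho> * r s)" by (intro continuous_intros r)
  have "\<exists>p. \<forall>t>0. R t = iter_int m (\<lambda>s. Gamma \<rho> * r s) t + (\<Sum>i<m. p i * of_real t ^ i)"
  proof (rule iter_deriv_taylor[OF _ _ cr])
    show "iter_deriv i R differentiable at t" if "i < m" "0 < t" for i t
      using diff that unfolding prabhakar_differentiable_def RL_differentiable_def R_def a_def m_def by blast
    show "iter_deriv m R t = Gamma \<rho> * r t" if "0 < t" for t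
      using eq[OF that] G
      unfolding prabhakar_derivative_def RL_derivative_def R_def a_def[symmetric] m_def[symmetric] \<rho>_def[symmetric]
      by (simp add: field_simps)
  qed
  then obtain p where p: "\<And>t. 0 < t \<Longrightarrow> R t = iter_int m (\<lambda>s. Gamma \<rho> * r s) t + (\<Sum>i<m. p i * of_real t ^ i)"
    by blast
  have I: "iter_int m (\<lambda>s. Gamma \<rho> * r s) t = Gamma \<rho> * lconv (rl_kernel (of_nat m)) r t" for t
    using m1 by (simp add: iter_int_def lconv_scale_right)
  \<comment> \<open>The size of the kernel gives a factor t^\<mu> with \<mu> \<ge> m - 1, which is
    equality for \<beta> = 1. The limit 0 therefore has to come from the supremum of f over [0, t],
    which tends to 0 because f 0 = 0.\<close>
  have lim_g: "((\<lambda>t. g t / of_real t ^ (m - 1)) \<longlongrightarrow> 0) (at_right 0)"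
  proof -
    obtain D where D: "0 < D" "\<And>h S t. continuous_on {0..} h \<Longrightarrow> 0 < t \<Longrightarrow> t \<le> 1 \<Longrightarrow>
       (\<And>x. 0 \<le> x \<Longrightarrow> x \<le> t \<Longrightarrow> norm (h x) \<le> S) \<Longrightarrow>
       norm (lconv (ml_kernel \<alpha> w (- of_real \<gamma>) (of_real \<mu>)) h t) \<le> D * S * t powr \<mu>"
      using lconv_ml_kernel_small[OF \<mu> \<alpha>, where w = w and c = "- of_real \<gamma>"] by blast
    show ?thesis
    proof (rule tendstoI)
      fix e :: real assume e: "0 < e"
      have "0 < e / (2 * D)" using e D(1) by simp
      then obtain d where d: "0 < d" "\<And>x. 0 \<le> x \<Longrightarrow> x < d \<Longrightarrow> norm (f x) < e / (2 * D)"
        using f unfolding continuous_on_iff by (force simp: dist_norm)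
      have "\<forall>\<^sub>F t in at_right 0. t < min d 1"
        using d(1) by (intro eventually_at_right_less[THEN eventually_mono] order_tendstoD(2)[OF tendsto_ident_at]) auto
      moreover have "\<forall>\<^sub>F t in at_right 0. 0 < (t :: real)" by (rule eventually_at_right_less)
      ultimately show "\<forall>\<^sub>F t in at_right 0. dist (g t / of_real t ^ (m - 1)) 0 < e"
      proof eventually_elim
        case (elim t)
        have "norm (g t) \<le> D * (e / (2 * D)) * t powr \<mu>"
          unfolding g_def using elim by (intro D(2) f less_imp_le[OF d(2)]) auto
        also have "\<dots> = (e / 2) * t powr \<mu>" using D(1) by simp
        also have "\<dots> \<le> (e / 2) * t powr real (m - 1)"
        proof (intro mult_left_mono powr_mono')
          show "real (m - 1) \<le> \<mu>" using \<beta> m1 by (simp add: \<mu>_def of_nat_diff)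
        qed (use elim e in auto)
        also have "\<dots> = (e / 2) * t ^ (m - 1)" using elim by (simp only: powr_realpow)
        finally have "norm (g t / of_real t ^ (m - 1)) \<le> e / 2"
          using elim by (simp add: norm_divide norm_power divide_le_eq)
        then show ?case using e by simp
      qed
    qed
  qed
  \<comment> \<open>Here r is only bounded near 0, but m integrations already give order
    t^m.\<close>
  have lim_I: "((\<lambda>t. lconv (rl_kernel (of_nat m)) r t / of_real t ^ (m - 1)) \<longlongrightarrow> 0) (at_right 0)"
  proof -
    have "0 < real m" using m1 by simp
    from lconv_ml_kernel_small[OF this \<alpha>, where w = w and c = 0]
    obtain D where D: "0 < D" "\<And>h S t. continuous_on {0..} h \<Longrightarrow> 0 < t \<Longrightarrow> t \<le> 1 \<Longrightarrow>
       (\<And>x. 0 \<le> x \<Longrightarrow> x \<le> t \<Longrightarrow> norm (h x) \<le> S) \<Longrightarrow>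
       norm (lconv (rl_kernel (of_nat m)) h t) \<le> D * S * t powr (real m)"
      by (auto simp: ml_kernel_0_fun)
    obtain S where S: "0 < S" "\<And>x. 0 \<le> x \<Longrightarrow> x \<le> 1 \<Longrightarrow> norm (r x) \<le> S"
      using continuous_on_bounded_Icc[OF r, of 1] by blast
    show ?thesis
    proof (rule Lim_null_comparison)
      have "\<forall>\<^sub>F t in at_right 0. t < (1 :: real)"
        by (intro order_tendstoD(2)[OF tendsto_ident_at]) auto
      moreover have "\<forall>\<^sub>F t in at_right 0. 0 < (t :: real)" by (rule eventually_at_right_less)
      ultimately show "\<forall>\<^sub>F t in at_right 0. norm (lconv (rl_kernel (of_nat m)) r t / of_real t ^ (m - 1)) \<le> D * S * t"
      proof eventually_elim
        case (elim t)
        have "norm (lconv (rl_kernel (of_nat m)) r t) \<le> D * S * t powr (real m)"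
          using elim by (intro D(2) r S(2)) auto
        also have "\<dots> = D * S * t * t ^ (m - 1)"
          using elim m1 by (simp add: powr_realpow power_eq_if)
        finally show ?case using elim by (simp add: norm_divide norm_power divide_le_eq)
      qed
      have "((\<lambda>t. D * S * t) \<longlongrightarrow> D * S * 0) (at_right 0)" by (intro tendsto_intros)
      then show "((\<lambda>t. D * S * t) \<longlongrightarrow> 0) (at_right 0)" by simp
    qed
  qed
  have "((\<lambda>t. Gamma \<rho> * (g t / of_real t ^ (m - 1)) - Gamma \<rho> * (lconv (rl_kernel (of_nat m)) r t / of_real t ^ (m - 1)))
     \<longlongrightarrow> Gamma \<rho> * 0 - Gamma \<rho> * 0) (at_right 0)"
    by (intro tendsto_intros lim_g lim_I)
  moreover have "\<forall>\<^sub>F t in at_right 0. Gamma \<rho> * (g t / of_real t ^ (m - 1)) - Gamma \<rho> * (lconv (rl_kernel (of_nat m)) r t / of_real t ^ (m - 1)) =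
       (\<Sum>i<m. p i * of_real t ^ i) / of_real t ^ (m - 1)"
  proof -
    have "Gamma \<rho> * (g t / of_real t ^ (m - 1)) - Gamma \<rho> * (lconv (rl_kernel (of_nat m)) r t / of_real t ^ (m - 1)) =
       (\<Sum>i<m. p i * of_real t ^ i) / of_real t ^ (m - 1)" if "0 < t" for t
    proof -
      have "(\<Sum>i<m. p i * of_real t ^ i) = Gamma \<rho> * g t - Gamma \<rho> * lconv (rl_kernel (of_nat m)) r t"
        using p[OF that] unfolding R I by simp
      then show ?thesis by (simp add: diff_divide_distrib)
    qed
    then show ?thesis by (simp add: eventually_at_filter)
  qed
  ultimately have lim_p: "((\<lambda>t. (\<Sum>i<m. p i * of_real t ^ i) / of_real t ^ (m - 1)) \<longlongrightarrow> 0) (at_right 0)"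
    by (simp only: tendsto_cong mult_zero_right diff_zero)
  have g_eq: "g s = lconv (rl_kernel (of_nat m)) r s" for s
  proof (cases "0 < s")
    case True
    have "(\<Sum>i<m. p i * of_real s ^ i) = 0"
      using poly_small_imp_0[OF lim_p] by (intro sum.neutral) auto
    then show ?thesis using p[OF True] G unfolding R I by simp
  qed (simp add: g_def lconv_nonpos)
  let ?K = "ml_kernel \<alpha> w (of_real \<gamma>) (of_real \<beta>)"
  have K: "loc_integrable ?K" using \<beta> \<alpha> by (intro loc_integrable_ml_kernel) auto
  have gm: "loc_integrable (rl_kernel (of_nat m))" using m1 by (intro loc_integrable_rl_kernel) auto
  have Kr: "continuous_on {0..} (lconv ?K r)" by (rule continuous_on_lconv[OF K r])
  \<comment> \<open>The parameters \<gamma> and -\<gamma> cancel and \<beta> + \<mu> = m, which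
    leaves plain m-fold integration.\<close>
  have 1: "lconv ?K g s = lconv (rl_kernel (of_nat m)) f s" for s
  proof -
    have "lconv ?K g s = lconv (lconv ?K (ml_kernel \<alpha> w (- of_real \<gamma>) (of_real \<mu>))) f s"
      unfolding g_def using \<mu> \<alpha> by (intro lconv_assoc K f loc_integrable_ml_kernel) auto
    also have "lconv ?K (ml_kernel \<alpha> w (- of_real \<gamma>) (of_real \<mu>)) = rl_kernel (of_nat m)"
      using \<mu> \<beta> \<alpha> by (simp add: fun_eq_iff lconv_ml_kernel ml_kernel_0) (simp add: \<mu>_def)
    finally show ?thesis .
  qed
  have 2: "lconv ?K g s = lconv (rl_kernel (of_nat m)) (lconv ?K r) s" for s
  proof -
    have "lconv ?K g s = lconv ?K (lconv (rl_kernel (of_nat m)) r) s"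
      by (rule lconv_cong) (simp_all add: g_eq)
    also have "\<dots> = lconv (lconv ?K (rl_kernel (of_nat m))) r s"
      by (rule lconv_assoc[OF K gm r])
    also have "lconv ?K (rl_kernel (of_nat m)) = lconv (rl_kernel (of_nat m)) ?K"
      by (simp add: fun_eq_iff lconv_commute)
    also have "lconv (lconv (rl_kernel (of_nat m)) ?K) r s = lconv (rl_kernel (of_nat m)) (lconv ?K r) s"
      by (rule lconv_assoc[OF gm K r, symmetric])
    finally show ?thesis .
  qed
  show ?thesis
  proof (cases "0 < t")
    case True
    \<comment> \<open>The difference is written as a sum with factor -1 so that additivity and
      scaling of \<open>lconv\<close> apply literally.\<close>
    have "f t + (- 1) * lconv ?K r t = 0"
    proof (rule iter_int_eq_0D[OF _ _ True, where m = m])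
      show "continuous_on {0..} (\<lambda>t. f t + (- 1) * lconv ?K r t)" by (intro continuous_intros f Kr)
      fix s :: real
      have "lconv (rl_kernel (of_nat m)) (\<lambda>t. f t + (- 1) * lconv ?K r t) s =
         lconv (rl_kernel (of_nat m)) f s + lconv (rl_kernel (of_nat m)) (\<lambda>t. (- 1) * lconv ?K r t) s"
        by (intro lconv_add_right gm f continuous_intros Kr)
      also have "\<dots> = 0" by (simp only: lconv_scale_right 1[symmetric] 2[symmetric]) simp
      finally show "iter_int m (\<lambda>t. f t + (- 1) * lconv ?K r t) s = 0"
        using m1 by (simp add: iter_int_def)
    qed
    then show ?thesis by simp
  next
    case False
    then show ?thesis using t f by (simp add: lconv_nonpos)
  qed
qed

subsection \<open>The Cauchy problem\<close>

text \<open>A family of one interval, the one between x and y, suffices; the right end x + 1 leaves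
  room for y on both sides of x.\<close>

lemma absolutely_continuous_imp_continuous:
  fixes f :: "real \<Rightarrow> real"
  assumes ac: "\<And>T. T > 0 \<Longrightarrow> absolutely_continuous_fun 0 T f"
  shows "continuous_on {0..} f"
  unfolding continuous_on_iff
proof (intro ballI allI impI)
  fix x e :: real assume x: "x \<in> {0..}" and e: "0 < e"
  have "absolutely_continuous_fun 0 (x + 1) f" using x by (intro ac) auto
  from this[unfolded absolutely_continuous_fun_def, rule_format, OF e]
  obtain \<rho> where \<rho>: "0 < \<rho>" and small: "\<forall>(n::nat) a b. (\<forall>i<n. 0 \<le> a i \<and> a i \<le> b i \<and> b i \<le> x + 1) \<and>
     disjoint_family_on (\<lambda>i. {a i<..<b i}) {..<n} \<and> (\<Sum>i<n. b i - a i) < \<rho> \<longrightarrow> (\<Sum>i<n. dist (f (a i)) (f (b i))) < e"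
    by (elim exE conjE) rule
  show "\<exists>d>0. \<forall>x'\<in>{0..}. dist x' x < d \<longrightarrow> dist (f x') (f x) < e"
  proof (intro exI[of _ "min \<rho> 1"] conjI ballI impI)
    fix y :: real assume y: "y \<in> {0..}" "dist y x < min \<rho> 1"
    have "(\<Sum>i<Suc 0. dist (f ((\<lambda>_. min x y) i)) (f ((\<lambda>_. max x y) i))) < e"
      by (rule small[THEN spec, THEN spec, THEN spec, THEN mp])
         (use x y in \<open>auto simp: disjoint_family_on_def dist_real_def\<close>)
    then show "dist (f y) (f x) < e" by (simp add: min_def max_def dist_commute split: if_splits)
  qed (use \<rho> in simp)
qed

lemma funpow_back_shift: "(back_shift ^^ i) q k = (if i \<le> k then q (k - i) else 0)"
  by (induction i arbitrary: k) (auto simp: back_shift_def Suc_diff_Suc)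

lemma fps_of_shift_eq: "fps_of_shift F q k = (\<Sum>i\<le>k. fps_nth F i * q (k - i))"
  unfolding fps_of_shift_def by (intro sum.cong) (auto simp: funpow_back_shift)

text \<open>The Picard iteration in algebraic form: the remainder after N steps is explicit, so
  convergence is a matter of bounding F^N and X N.\<close>

lemma fps_fixed_point_iterate:
  fixes X :: "nat \<Rightarrow> complex fps"
  assumes "\<And>n. X n = fps_const (x n) + F * X (Suc n)"
  shows "X 0 = (\<Sum>n<N. fps_const (x n) * F ^ n) + F ^ N * X N"
proof (induction N)
  case (Suc N)
  have "F ^ N * X N = fps_const (x N) * F ^ N + F ^ Suc N * X (Suc N)"
    by (subst assms) (simp add: algebra_simps)
  with Suc show ?case by simp
qed simp

text \<open>The time t is fixed and X n collects, over the index k, the values at t of P k convolved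
  with K n. Convolving the Volterra equation with K n gives X n = x n + F X (n + 1). The remainder
  F^N X N tends to 0 in each coefficient, because its bound is a multiple of the general term W^N y
  N of a convergent series.\<close>

lemma volterra_system_solution:
  fixes P :: "nat \<Rightarrow> real \<Rightarrow> complex" and \<alpha> \<beta> \<gamma> w t :: real
  assumes \<alpha>: "0 < \<alpha>" and \<beta>: "0 < \<beta>" and \<gamma>: "0 \<le> \<gamma>" and F: "wiener F"
    and P: "\<And>k. continuous_on {0..} (P k)"
    and eq: "\<And>k s. 0 < s \<Longrightarrow> P k s = (if k = 0 then 1 else 0) +
        lconv (ml_kernel \<alpha> w (of_real \<gamma>) (of_real \<beta>)) (\<lambda>s. \<Sum>i\<le>k. fps_nth F i * P (k - i) s) s"
    and t: "0 < t"
  defines "x \<equiv> \<lambda>n. ml_kernel \<alpha> w (of_real (\<gamma> * real n)) (of_real (\<beta> * real n + 1)) t"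
  shows "summable (\<lambda>n. norm (x n) * wiener_norm F ^ n)" "(\<lambda>n. x n * fps_nth (F ^ n) k) sums P k t"
proof -
  define K where "K = (\<lambda>n. ml_kernel \<alpha> w (of_real (\<gamma> * real n)) (of_real (\<beta> * real n)))"
  \<comment> \<open>\<open>K 0\<close> is the zero function, since \<open>Gamma 0 = 0\<close>, and
    not the unit of convolution; hence the separate case n = 0.\<close>
  define X where "X = (\<lambda>n. Abs_fps (\<lambda>k. if n = 0 then P k t else lconv (K n) (P k) t))"
  define W where "W = wiener_norm F"
  define y where "y = (\<lambda>n. Re (ml_kernel \<alpha> \<bar>w\<bar> (of_real (\<gamma> * real n)) (of_real (\<beta> * real n + 1)) t))"
  define r where "r = (\<lambda>k s. \<Sum>i\<le>k. fps_nth F i * P (k - i) s)"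
  have W: "0 \<le> W" unfolding W_def by (rule wiener_norm_nonneg[OF F])
  have K: "loc_integrable (K n)" if "0 < n" for n
    unfolding K_def using that \<alpha> \<beta> by (intro loc_integrable_ml_kernel) auto
  have r: "continuous_on {0..} (r k)" for k unfolding r_def by (intro continuous_intros P)
  have KK: "lconv (K n) (K 1) = K (Suc n)" if "0 < n" for n
    unfolding K_def using that \<alpha> \<beta>
    by (auto simp: fun_eq_iff lconv_ml_kernel algebra_simps simp flip: of_real_add of_real_mult)
  have Kr: "lconv (K (Suc n)) (r k) t = (\<Sum>i\<le>k. fps_nth F i * lconv (K (Suc n)) (P (k - i)) t)" for n k
    unfolding r_def by (subst lconv_sum_right) (auto intro!: K continuous_intros P simp: lconv_scale_right)
  have K1: "lconv (K n) (\<lambda>_. 1) t = x n" if "0 < n" for n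
    unfolding K_def x_def using that \<alpha> \<beta> by (subst lconv_ml_kernel_one) auto
  have X: "X n = fps_const (x n) + F * X (Suc n)" for n
  proof (rule fps_ext)
    fix k
    have RHS: "fps_nth (fps_const (x n) + F * X (Suc n)) k = (if k = 0 then x n else 0) + lconv (K (Suc n)) (r k) t"
      unfolding Kr by (simp add: X_def fps_mult_nth atLeast0AtMost)
    show "fps_nth (X n) k = fps_nth (fps_const (x n) + F * X (Suc n)) k"
    proof (cases "n = 0")
      case True
      have "x 0 = 1" using t by (simp add: x_def ml_kernel_0 rl_kernel_1)
      moreover have "K 1 = ml_kernel \<alpha> w (of_real \<gamma>) (of_real \<beta>)" by (simp add: K_def)
      ultimately show ?thesis using True eq[OF t, of k] unfolding RHS by (simp add: X_def r_def)
    next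
      case False
      have "fps_nth (X n) k = lconv (K n) (P k) t" using False by (simp add: X_def)
      also have "\<dots> = lconv (K n) (\<lambda>s. (if k = 0 then 1 else 0) * 1 + lconv (K 1) (r k) s) t"
        by (rule lconv_cong) (use eq in \<open>auto simp: r_def K_def\<close>)
      also have "\<dots> = lconv (K n) (\<lambda>s. (if k = 0 then 1 else 0) * 1) t + lconv (K n) (lconv (K 1) (r k)) t"
        using False by (intro lconv_add_right K continuous_intros continuous_on_lconv r) auto
      also have "lconv (K n) (\<lambda>s. (if k = 0 then 1 else 0) * 1) t = (if k = 0 then 1 else 0) * x n"
        using False K1[of n] by (simp only: lconv_scale_right)
      also have "lconv (K n) (lconv (K 1) (r k)) t = lconv (K (Suc n)) (r k) t"
        using False KK[of n] lconv_assoc[OF K[of n] K[of 1] r[of k], of t] by simp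
      finally show ?thesis unfolding RHS by simp
    qed
  qed
  have xy: "norm (x n) \<le> y n" for n
    unfolding x_def y_def using \<alpha> \<beta> \<gamma> by (intro norm_ml_kernel_le(1)) (auto intro: add_nonneg_pos)
  have y0: "0 \<le> y n" for n using xy[of n] norm_ge_zero[of "x n"] by linarith
  have sy: "summable (\<lambda>n. W ^ n * y n)"
    unfolding y_def by (rule summable_ml_kernel_powers[OF \<alpha> \<beta> \<gamma> W])
  then show "summable (\<lambda>n. norm (x n) * wiener_norm F ^ n)"
  proof (rule summable_comparison_test')
    show "norm (norm (x n) * wiener_norm F ^ n) \<le> W ^ n * y n" for n
      using W mult_right_mono[OF xy[of n], of "W ^ n"] by (simp add: W_def[symmetric] mult.commute)
  qed
  \<comment> \<open>A bound for P j on [0, t] by compactness. It may grow with j in any way, because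
    coefficient k of the remainder involves only j \<le> k.\<close>
  define S where "S = (\<lambda>j. SOME C. 0 < C \<and> (\<forall>s. 0 \<le> s \<longrightarrow> s \<le> t \<longrightarrow> norm (P j s) \<le> C))"
  have S: "0 < S j \<and> (\<forall>s. 0 \<le> s \<longrightarrow> s \<le> t \<longrightarrow> norm (P j s) \<le> S j)" for j
    unfolding S_def by (rule someI_ex) (use continuous_on_bounded_Icc[OF P, of t j] in metis)
  have Xle: "norm (fps_nth (X n) j) \<le> S j * y n" if n: "0 < n" for n j
  proof -
    have "norm (lconv (K n) (P j) t) \<le> S j * Re (lconv (ml_kernel \<alpha> \<bar>w\<bar> (of_real (\<gamma> * real n)) (of_real (\<beta> * real n))) (\<lambda>_. 1) t)"
    proof (rule norm_lconv_le[OF K[OF n] P])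
      show "loc_integrable (ml_kernel \<alpha> \<bar>w\<bar> (of_real (\<gamma> * real n)) (of_real (\<beta> * real n)))"
        using n \<alpha> \<beta> by (intro loc_integrable_ml_kernel) auto
      show "norm (K n s) \<le> Re (ml_kernel \<alpha> \<bar>w\<bar> (of_real (\<gamma> * real n)) (of_real (\<beta> * real n)) s)" for s
        unfolding K_def using n \<alpha> \<beta> \<gamma> by (intro norm_ml_kernel_le(1)) auto
    qed (use S in auto)
    also have "Re (lconv (ml_kernel \<alpha> \<bar>w\<bar> (of_real (\<gamma> * real n)) (of_real (\<beta> * real n))) (\<lambda>_. 1) t) = y n"
      unfolding y_def using n \<alpha> \<beta> by (subst lconv_ml_kernel_one) auto
    finally show ?thesis using n by (simp add: X_def)
  qed
  have "(\<lambda>N. P k t - (\<Sum>n<N. x n * fps_nth (F ^ n) k)) \<longlonglongrightarrow> 0"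
  proof (rule Lim_null_comparison)
    show "\<forall>\<^sub>F N in sequentially. norm (P k t - (\<Sum>n<N. x n * fps_nth (F ^ n) k)) \<le> (\<Sum>i\<le>k. S (k - i)) * (W ^ N * y N)"
      using eventually_gt_at_top[of 0]
    proof eventually_elim
      case (elim N)
      have "P k t = fps_nth (X 0) k" by (simp add: X_def)
      also have "\<dots> = (\<Sum>n<N. x n * fps_nth (F ^ n) k) + fps_nth (F ^ N * X N) k"
        by (subst fps_fixed_point_iterate[where X = X and x = x and F = F and N = N, OF X]) (simp add: fps_sum_nth)
      finally have "P k t - (\<Sum>n<N. x n * fps_nth (F ^ n) k) = (\<Sum>i\<le>k. fps_nth (F ^ N) i * fps_nth (X N) (k - i))"
        by (simp add: fps_mult_nth atLeast0AtMost)
      also have "norm \<dots> \<le> (\<Sum>i\<le>k. norm (fps_nth (F ^ N) i * fps_nth (X N) (k - i)))" by (rule norm_sum)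
      also have "\<dots> \<le> (\<Sum>i\<le>k. W ^ N * (S (k - i) * y N))"
        unfolding norm_mult
      proof (intro sum_mono mult_mono Xle elim)
        show "norm (fps_nth (F ^ N) i) \<le> W ^ N" for i
          using wiener_power[OF F, of N] norm_nth_le_wiener_norm[of "F ^ N" i] unfolding W_def by (meson order_trans)
      qed (use W in auto)
      also have "\<dots> = (\<Sum>i\<le>k. S (k - i)) * (W ^ N * y N)"
        by (subst sum_distrib_right) (simp add: mult_ac)
      finally show ?case .
    qed
    have "(\<lambda>N. (\<Sum>i\<le>k. S (k - i)) * (W ^ N * y N)) \<longlonglongrightarrow> (\<Sum>i\<le>k. S (k - i)) * 0"
      by (intro tendsto_intros summable_LIMSEQ_zero sy)
    then show "(\<lambda>N. (\<Sum>i\<le>k. S (k - i)) * (W ^ N * y N)) \<longlonglongrightarrow> 0" by simp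
  qed
  from tendsto_diff[OF tendsto_const[of "P k t"] this]
  show "(\<lambda>n. x n * fps_nth (F ^ n) k) sums P k t" by (simp add: sums_def)
qed

section \<open>The generating function\<close>

text \<open>The solution formula gives p_k(t) as coefficient k of the series in powers of the
  operator, and \<open>wiener_compose\<close> evaluates that series at u. Both summability claims
  are part of the conclusion because \<open>suminf\<close> is total and the equality alone would not
  assert convergence.\<close>

theorem mainTheorem6:
  fixes p :: "nat \<Rightarrow> real \<Rightarrow> real"
    and \<delta> \<eta> l \<nu> \<omega> \<gamma> \<alpha> \<beta> :: real
    and \<theta> :: complex
  assumes "\<delta> > 0" and "\<eta> > 0" and "l > 0" and "\<nu> > 0"
    and "0 < \<nu> * of_int \<lceil>\<delta>\<rceil>" and "\<nu> * of_int \<lceil>\<delta>\<rceil> < 1"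
    and "\<omega> > 0" and "\<gamma> \<ge> 0"
    and "0 < \<alpha>" and "\<alpha> \<le> 1" and "0 < \<beta>" and "\<beta> \<le> 1"
    and "\<gamma> \<noteq> 0 \<Longrightarrow> \<forall>r::nat. r \<le> nat \<lceil>\<gamma>\<rceil> \<longrightarrow>
           0 < \<beta> * of_int \<lceil>\<gamma>\<rceil> / \<gamma> - of_nat r * \<alpha> \<and>
           \<beta> * of_int \<lceil>\<gamma>\<rceil> / \<gamma> - of_nat r * \<alpha> < 1"
    and "Re \<theta> > 0"
    and abs_cont: "\<And>k T. T > 0 \<Longrightarrow> absolutely_continuous_fun 0 T (p k)"
    and diff: "\<And>k. reg_prabhakar_differentiable \<theta> \<gamma> \<alpha> \<beta> (- \<omega>) (\<lambda>s. of_real (p k s))"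
    and equation: "\<And>k t. t > 0 \<Longrightarrow>
           reg_prabhakar_derivative \<theta> \<gamma> \<alpha> \<beta> (- \<omega>) (\<lambda>s. of_real (p k s)) t =
           - fps_of_shift (fps_expansion (shift_symbol \<eta> l \<nu> \<delta>) 0) (\<lambda>j. of_real (p j t)) k"
    and initial: "\<And>k. p k 0 = (if k = 0 then 1 else 0)"
  shows "\<forall>(u::complex) (t::real). norm u \<le> 1 \<longrightarrow> t \<ge> 0 \<longrightarrow>
           summable (\<lambda>k. u ^ k * of_real (p k t)) \<and>
           summable (\<lambda>j. (- (shift_symbol \<eta> l \<nu> \<delta> u * of_real (t powr \<beta>))) ^ j *
              mittag_leffler3 (of_real \<alpha>) (of_real (\<beta> * of_nat j + 1)) (of_real (\<gamma> * of_nat j))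
                (of_real (- \<omega> * t powr \<alpha>))) \<and>
           (\<Sum>k. u ^ k * of_real (p k t)) =
           (\<Sum>j. (- (shift_symbol \<eta> l \<nu> \<delta> u * of_real (t powr \<beta>))) ^ j *
              mittag_leffler3 (of_real \<alpha>) (of_real (\<beta> * of_nat j + 1)) (of_real (\<gamma> * of_nat j))
                (of_real (- \<omega> * t powr \<alpha>)))"
proof (intro allI impI)
  fix u :: complex and t :: real
  assume u: "norm u \<le> 1" and t: "t \<ge> 0"
  \<comment> \<open>This extracts \<nu> < 1 from the ceiling condition, as required for the
    nonnegative coefficients of A.\<close>
  have "1 \<le> \<lceil>\<delta>\<rceil>" using \<open>\<delta> > 0\<close> by linarith
  then have "\<nu> * 1 \<le> \<nu> * of_int \<lceil>\<delta>\<rceil>" using \<open>\<nu> > 0\<close> by (intro mult_left_mono) auto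
  then have \<nu>: "\<nu> < 1" using \<open>\<nu> * of_int \<lceil>\<delta>\<rceil> < 1\<close> by linarith
  define \<Phi> where "\<Phi> = fps_expansion (shift_symbol \<eta> l \<nu> \<delta>) 0"
  note expansion = shift_symbol_expansion[OF \<open>\<nu> > 0\<close> \<nu> \<open>\<eta> > 0\<close> \<open>l > 0\<close>, where \<delta> = \<delta>, folded \<Phi>_def]
  \<comment> \<open>The minus sign of the equation is put into the power series, so the solution
    runs over powers of -\<Phi>.\<close>
  have w: "wiener (- \<Phi>)" using expansion(1) by (simp add: wiener_def)
  have eval: "(\<Sum>k. fps_nth (- \<Phi>) k * u ^ k) = - shift_symbol \<eta> l \<nu> \<delta> u"
    using sums_minus[OF expansion(2)[OF u]] by (simp add: sums_iff)
  define P where "P = (\<lambda>k s. complex_of_real (p k s))"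
  have Pf: "(\<lambda>s. complex_of_real (p k s)) = P k" for k by (simp add: P_def)
  have P: "continuous_on {0..} (P k)" for k
    unfolding P_def by (intro continuous_on_of_real absolutely_continuous_imp_continuous abs_cont)
  have P0: "P k 0 = (if k = 0 then 1 else 0)" for k by (simp add: P_def initial)
  \<comment> \<open>Continuity turns the one-sided limit in the regularized derivative into the
    initial value, so the function to be inverted vanishes at 0.\<close>
  have Lim: "Lim (at_right 0) (P k) = P k 0" for k
  proof (rule tendsto_Lim)
    have "(P k \<longlongrightarrow> P k 0) (at 0 within {0..})" using P[of k] by (simp add: continuous_on_def)
    then show "(P k \<longlongrightarrow> P k 0) (at_right 0)" by (rule tendsto_within_subset) auto
  qed simp
  let ?term = "\<lambda>j. (- (shift_symbol \<eta> l \<nu> \<delta> u * of_real (t powr \<beta>))) ^ j *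
              mittag_leffler3 (of_real \<alpha>) (of_real (\<beta> * of_nat j + 1)) (of_real (\<gamma> * of_nat j))
                (of_real (- \<omega> * t powr \<alpha>))"
  have "\<exists>s. (\<lambda>k. u ^ k * P k t) sums s \<and> ?term sums s"
  \<comment> \<open>The kernels are 0 at t = 0 and cannot represent the solution there. Directly,
    \<open>0 powr \<beta> = 0\<close> leaves only the term j = 0, which equals 1, and p_0(0) = 1 is
    the only nonzero value on the other side.\<close>
  proof (cases "t = 0")
    case True
    have ml: "mittag_leffler3 (of_real \<alpha>) 1 0 0 = 1"
    proof -
      have "mittag_leffler3 (of_real \<alpha>) 1 0 0 = (\<Sum>r\<in>{0}. 0 ^ r * pochhammer 0 r / (fact r * Gamma (of_real \<alpha> * of_nat r + 1)))"
        unfolding mittag_leffler3_def by (rule suminf_finite) auto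
      then show ?thesis by simp
    qed
    have "(\<lambda>k. u ^ k * P k t) sums (\<Sum>k\<in>{0}. u ^ k * P k t)"
      by (rule sums_finite) (auto simp: True P0)
    moreover have "?term sums (\<Sum>j\<in>{0}. ?term j)"
      by (rule sums_finite) (auto simp: True)
    moreover have "(\<Sum>k\<in>{0}. u ^ k * P k t) = (\<Sum>j\<in>{0}. ?term j)"
      using ml by (simp add: True P0)
    ultimately show ?thesis by auto
  next
    case False
    then have t: "0 < t" using t by simp
    have volterra: "P k s = (if k = 0 then 1 else 0) +
        lconv (ml_kernel \<alpha> (- \<omega>) (of_real \<gamma>) (of_real \<beta>)) (\<lambda>s. \<Sum>i\<le>k. fps_nth (- \<Phi>) i * P (k - i) s) s"
      if s: "0 < s" for k s
    proof -
      have "P k s - P k 0 = lconv (ml_kernel \<alpha> (- \<omega>) (of_real \<gamma>) (of_real \<beta>)) (\<lambda>s. \<Sum>i\<le>k. fps_nth (- \<Phi>) i * P (k - i) s) s"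
      proof (rule prabhakar_inversion)
        show "prabhakar_differentiable \<theta> \<gamma> \<alpha> \<beta> (- \<omega>) (\<lambda>s. P k s - P k 0)"
          using diff[of k] unfolding Pf reg_prabhakar_differentiable_def Lim .
        show "prabhakar_derivative \<theta> \<gamma> \<alpha> \<beta> (- \<omega>) (\<lambda>s. P k s - P k 0) s = (\<Sum>i\<le>k. fps_nth (- \<Phi>) i * P (k - i) s)"
          if "0 < s" for s
          using equation[OF that, of k]
          unfolding Pf reg_prabhakar_derivative_def Lim \<Phi>_def[symmetric] fps_of_shift_eq
          by (simp add: P_def sum_negf)
      qed (use s assms in \<open>auto intro!: continuous_intros P\<close>)
      then show ?thesis by (simp add: P0 algebra_simps)
    qed
    define x where "x = (\<lambda>n. ml_kernel \<alpha> (- \<omega>) (of_real (\<gamma> * real n)) (of_real (\<beta> * real n + 1)) t)"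
    have solution: "summable (\<lambda>n. norm (x n) * wiener_norm (- \<Phi>) ^ n)"
      "(\<lambda>n. x n * fps_nth ((- \<Phi>) ^ n) k) sums P k t" for k
      unfolding x_def
      by (rule volterra_system_solution[OF \<open>0 < \<alpha>\<close> \<open>0 < \<beta>\<close> \<open>\<gamma> \<ge> 0\<close> w P _ t], rule volterra, assumption)+
    \<comment> \<open>With b = x the composed series has the coefficients P k t, so its evaluation
      at u is the generating function.\<close>
    note compose = wiener_compose[OF w solution(1)]
    have P_eq: "(\<Sum>n. x n * fps_nth ((- \<Phi>) ^ n) k) = P k t" for k
      using solution(2)[of k] by (rule sums_unique[symmetric])
    have term_eq: "x j * (- shift_symbol \<eta> l \<nu> \<delta> u) ^ j = ?term j" for j
    proof -
      have "x j = of_real t powr (of_real (\<beta> * real j + 1) - 1) * mittag_leffler3 (of_real \<alpha>) (of_real (\<beta> * real j + 1)) (of_real (\<gamma> * real j)) (of_real (- \<omega> * t powr \<alpha>))"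
        unfolding x_def using t \<open>0 < \<alpha>\<close> \<open>0 < \<beta>\<close> by (intro ml_kernel_mittag_leffler3[symmetric]) (auto intro: add_nonneg_pos)
      also have "complex_of_real t powr (of_real (\<beta> * real j + 1) - 1) = of_real (t powr \<beta>) ^ j"
      proof -
        have h: "t powr (\<beta> * real j) = (t powr \<beta>) ^ j"
          using t by (simp only: powr_powr[symmetric]) (simp add: powr_realpow)
        have "complex_of_real t powr of_real (\<beta> * real j) = of_real ((t powr \<beta>) ^ j)"
          unfolding h[symmetric] by (rule powr_of_real[OF less_imp_le[OF t]])
        then show ?thesis unfolding of_real_power by simp
      qed
      finally have "x j = of_real (t powr \<beta>) ^ j * mittag_leffler3 (of_real \<alpha>) (of_real (\<beta> * real j + 1)) (of_real (\<gamma> * real j)) (of_real (- \<omega> * t powr \<alpha>))" .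
      then show ?thesis
        unfolding mult_minus_left[of "shift_symbol \<eta> l \<nu> \<delta> u", symmetric] power_mult_distrib by simp
    qed
    have "(\<lambda>k. u ^ k * P k t) sums (\<Sum>j. ?term j)"
      using compose(2)[OF u, unfolded eval term_eq fps_nth_Abs_fps P_eq]
      by (simp only: mult.commute[of "u ^ _"])
    moreover have "?term sums (\<Sum>j. ?term j)"
      using compose(3)[OF u, unfolded eval term_eq] by (rule summable_sums)
    ultimately show ?thesis by blast
  qed
  then obtain s where s: "(\<lambda>k. u ^ k * P k t) sums s" "?term sums s" by blast
  show "summable (\<lambda>k. u ^ k * of_real (p k t)) \<and> summable ?term \<and> (\<Sum>k. u ^ k * of_real (p k t)) = (\<Sum>j. ?term j)"
    using s unfolding P_def by (simp only: sums_iff)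
qed

end
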